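(* The following forty-two functions of the complex variable $p$ are equal to one another in a neighborhood of $p=0$. (Level 1) 1. $\dfrac{1}{(1+4p-8p^2)^{1/2}(1+228p-408p^2-128p^3-192p^4+768p^5-512p^6)^{1/2}}\,F_1\!\left(\dfrac{p(1-p)^3(1-4p)^{12}(1-2p)(1+2p)^3}{(1+4p-8p^2)^3(1+228p-408p^2-128p^3-192p^4+768p^5-512p^6)^3}\right)$ 2. $\dfrac{1}{(1-2p+4p^2)^{1/2}(1-6p+240p^2-920p^3+960p^4-96p^5+64p^6)^{1/2}}\,F_1\!\left(\dfrac{p^2(1-p)^6(1-4p)^6(1-2p)^2(1+2p)^6}{(1-2p+4p^2)^3(1-6p+240p^2-920p^3+960p^4-96p^5+64p^6)^3}\right)$ 3. $\dfrac{1}{(1+4p-8p^2)^{1/2}(1-12p+72p^2-128p^3-192p^4+768p^5-512p^6)^{1/2}}\,F_1\!\left(\dfrac{p^3(1-p)(1-4p)^4(1-2p)^3(1+2p)}{(1+4p-8p^2)^3(1-12p+72p^2-128p^3-192p^4+768p^5-512p^6)^3}\right)$ 4. $\dfrac{1}{(1-2p-2p^2)^{1/2}(1-6p+6p^2+16p^3+204p^4-456p^5-8p^6)^{1/2}}\,F_1\!\left(\dfrac{p^4(1-p)^{12}(1-4p)^3(1-2p)(1+2p)^3}{(1-2p-2p^2)^3(1-6p+6p^2+16p^3+204p^4-456p^5-8p^6)^3}\right)$ 5. $\dfrac{1}{(1-2p+4p^2)^{1/2}(1-6p+40p^3-96p^5+64p^6)^{1/2}}\,F_1\!\left(\dfrac{p^6(1-p)^2(1-4p)^2(1-2p)^6(1+2p)^2}{(1-2p+4p^2)^3(1-6p+40p^3-96p^5+64p^6)^3}\right)$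 6. $\dfrac{1}{(1-2p-2p^2)^{1/2}(1-6p+6p^2+16p^3-36p^4+24p^5-8p^6)^{1/2}}\,F_1\!\left(\dfrac{p^{12}(1-p)^4(1-4p)(1-2p)^3(1+2p)}{(1-2p-2p^2)^3(1-6p+6p^2+16p^3-36p^4+24p^5-8p^6)^3}\right)$ 7. $\dfrac{1}{(1-8p+4p^2)^{1/2}(1-240p+1932p^2-5888p^3+7728p^4-3840p^5+64p^6)^{1/2}}\,F_1\!\left(\dfrac{-p(1-p)^3(1-4p)^3(1-2p)^4(1+2p)^{12}}{(1-8p+4p^2)^3(1-240p+1932p^2-5888p^3+7728p^4-3840p^5+64p^6)^3}\right)$ 8. $\dfrac{1}{(1-8p+4p^2)^{1/2}(1+12p^2-128p^3+48p^4+64p^6)^{1/2}}\,F_1\!\left(\dfrac{-p^3(1-p)(1-4p)(1-2p)^{12}(1+2p)^4}{(1-8p+4p^2)^3(1+12p^2-128p^3+48p^4+64p^6)^3}\right)$ (Level 2) 9. $\dfrac{1}{1+20p-48p^2+32p^3-32p^4}\,F_2\!\left(\dfrac{p(1-p)^3(1-4p)^6(1-2p)(1+2p)^3}{(1+20p-48p^2+32p^3-32p^4)^4}\right)$ 10. $\dfrac{1}{1-4p+24p^2-40p^3-8p^4}\,F_2\!\left(\dfrac{p^2(1-p)^6(1-4p)^3(1-2p)(1+2p)^3}{(1-4p+24p^2-40p^3-8p^4)^4}\right)$ 11. $\dfrac{1}{1-4p+32p^3-32p^4}\,F_2\!\left(\dfrac{p^3(1-p)(1-4p)^2(1-2p)^3(1+2p)}{(1-4p+32p^3-32p^4)^4}\right)$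 12. $\dfrac{1}{1-4p+8p^3-8p^4}\,F_2\!\left(\dfrac{p^6(1-p)^2(1-4p)(1-2p)^3(1+2p)}{(1-4p+8p^3-8p^4)^4}\right)$ 13. $\dfrac{1}{1-28p+96p^2-112p^3+16p^4}\,F_2\!\left(-\dfrac{p(1-p)^3(1-4p)^3(1-2p)^2(1+2p)^6}{(1-28p+96p^2-112p^3+16p^4)^4}\right)$ 14. $\dfrac{1}{1-4p-16p^3+16p^4}\,F_2\!\left(-\dfrac{p^3(1-p)(1-4p)(1-2p)^6(1+2p)^2}{(1-4p-16p^3+16p^4)^4}\right)$ (Level 3) 15. $\dfrac{1}{(1+4p-8p^2)^2}\,F_3\!\left(\dfrac{p(1-p)(1-4p)^4(1-4p^2)}{(1+4p-8p^2)^6}\right)$ 16. $\dfrac{1}{(1-2p+4p^2)^2}\,F_3\!\left(\dfrac{p^2(1-p)^2(1-4p)^2(1-4p^2)^2}{(1-2p+4p^2)^6}\right)$ 17. $\dfrac{1}{(1-2p-2p^2)^2}\,F_3\!\left(\dfrac{p^4(1-p)^4(1-4p)(1-4p^2)}{(1-2p-2p^2)^6}\right)$ 18. $\dfrac{1}{(1-8p+4p^2)^2}\,F_3\!\left(-\dfrac{p(1-p)(1-4p)(1-4p^2)^4}{(1-8p+4p^2)^6}\right)$ (Level 4) 19. $\dfrac{1}{(1-2p)(1+2p)^3}\,F_4\!\left(\dfrac{p(1-p)^3(1-4p)^3}{(1-2p)^2(1+2p)^6}\right)$ 20. $\dfrac{1}{(1-2p)^3(1+2p)}\,F_4\!\left(\dfrac{p^3(1-p)(1-4p)}{(1-2p)^6(1+2p)^2}\right)$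 21. $\dfrac{1}{(1-4p)^3}\,F_4\!\left(-\dfrac{p(1-2p)(1+2p)^3(1-p)^3}{(1-4p)^6}\right)$ 22. $\dfrac{1}{1-4p}\,F_4\!\left(-\dfrac{p^3(1-2p)^3(1+2p)(1-p)}{(1-4p)^2}\right)$ 23. $\dfrac{1}{(1-2p)^{1/2}(1+2p)^{3/2}(1-4p)^{3/2}}\,F_4\!\left(-\dfrac{p^2(1-p)^6}{(1-2p)(1+2p)^3(1-4p)^3}\right)$ 24. $\dfrac{1}{(1-2p)^{3/2}(1+2p)^{1/2}(1-4p)^{1/2}}\,F_4\!\left(-\dfrac{p^6(1-p)^2}{(1-2p)^3(1+2p)(1-4p)}\right)$ (Level 6, functions $F$) 25. $\dfrac{1}{1-16p+24p^2+32p^3-32p^4}\,F_{6a}\!\left(\dfrac{p(1-p)(1-4p)^2(1-2p)(1+2p)}{(1-16p+24p^2+32p^3-32p^4)^2}\right)$ 26. $\dfrac{1}{1-4p-12p^2+32p^3-8p^4}\,F_{6a}\!\left(\dfrac{p^2(1-p)^2(1-4p)(1-2p)(1+2p)}{(1-4p-12p^2+32p^3-8p^4)^2}\right)$ 27. $\dfrac{1}{1+8p-48p^2+32p^3+16p^4}\,F_{6a}\!\left(\dfrac{-p(1-p)(1-4p)(1-2p)^2(1+2p)^2}{(1+8p-48p^2+32p^3+16p^4)^2}\right)$ 28. $\dfrac{1}{(1-2p+4p^2)(1+4p-8p^2)}\,F_{6b}\!\left(\dfrac{p(1-p)(1-4p)^2(1-2p)(1+2p)}{(1-2p+4p^2)^2(1+4p-8p^2)^2}\right)$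 29. $\dfrac{1}{(1-2p-2p^2)(1-2p+4p^2)}\,F_{6b}\!\left(\dfrac{p^2(1-p)^2(1-4p)(1-2p)(1+2p)}{(1-2p-2p^2)^2(1-2p+4p^2)^2}\right)$ 30. $\dfrac{1}{(1-2p+4p^2)(1-8p+4p^2)}\,F_{6b}\!\left(\dfrac{-p(1-p)(1-4p)(1-2p)^2(1+2p)^2}{(1-2p+4p^2)^2(1-8p+4p^2)^2}\right)$ 31. $\dfrac{1}{1+8p^2-32p^3+32p^4}\,F_{6c}\!\left(\dfrac{p(1-p)(1-4p)^2(1-2p)(1+2p)}{(1+8p^2-32p^3+32p^4)^2}\right)$ 32. $\dfrac{1}{1-4p+4p^2+8p^4}\,F_{6c}\!\left(\dfrac{p^2(1-p)^2(1-4p)(1-2p)(1+2p)}{(1-4p+4p^2+8p^4)^2}\right)$ 33. $\dfrac{1}{1-8p+32p^2-32p^3+16p^4}\,F_{6c}\!\left(\dfrac{-p(1-p)(1-4p)(1-2p)^2(1+2p)^2}{(1-8p+32p^2-32p^3+16p^4)^2}\right)$ (Level 6, functions $G$) 34. $\dfrac{1}{(1+2p)(1-p)}\,G_{6a}\!\left(\dfrac{p(1-4p)^2(1-2p)}{(1+2p)(1-p)}\right)$ 35. $\dfrac{1}{(1-2p)(1-p)^2}\,G_{6a}\!\left(\dfrac{p^2(1+2p)(1-4p)}{(1-2p)(1-p)^2}\right)$ 36. $\dfrac{1}{(1-p)(1-4p)(1-2p)^2}\,G_{6a}\!\left(\dfrac{-p(1+2p)^2}{(1-p)(1-4p)(1-2p)^2}\right)$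 37. $\dfrac{1}{(1-4p)^2}\,G_{6b}\!\left(\dfrac{p(1+2p)(1-2p)(1-p)}{(1-4p)^2}\right)$ 38. $\dfrac{1}{(1-2p)(1+2p)(1-4p)}\,G_{6b}\!\left(\dfrac{p^2(1-p)^2}{(1-2p)(1+2p)(1-4p)}\right)$ 39. $\dfrac{1}{(1-2p)^2(1+2p)^2}\,G_{6b}\!\left(\dfrac{-p(1-p)(1-4p)}{(1-2p)^2(1+2p)^2}\right)$ 40. $\dfrac{1}{(1-p)(1+2p)(1-4p)^2}\,G_{6c}\!\left(\dfrac{p(1-2p)}{(1-p)(1+2p)(1-4p)^2}\right)$ 41. $\dfrac{1}{(1+2p)(1-p)^2(1-4p)}\,G_{6c}\!\left(\dfrac{p^2(1-2p)}{(1+2p)(1-p)^2(1-4p)}\right)$ 42. $\dfrac{1}{(1-p)(1-4p)(1+2p)^2}\,G_{6c}\!\left(\dfrac{-p(1-2p)^2}{(1-p)(1-4p)(1+2p)^2}\right)$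
   Context: Fractional powers denote the branch equal to $1$ at $p=0$. The functions are defined by power series convergent near $0$: $$F_1(x)=\sum_{n\ge0}\binom{6n}{3n}\binom{3n}{2n}\binom{2n}{n}x^n,\quad F_2(x)=\sum_{n\ge0}\binom{4n}{2n}\binom{2n}{n}^2x^n,$$ $$F_3(x)=\sum_{n\ge0}\binom{3n}{n}\binom{2n}{n}^2x^n,\quad F_4(x)=\sum_{n\ge0}\binom{2n}{n}^3x^n.$$ For given parameters $(\alpha,\beta,\gamma)$ define sequences $t(n)$ and $T(n)$ by $t(0)=T(0)=1$ and, for all integers $n\ge0$, $$(n+1)^2t(n+1)=(\alpha n^2+\alpha n+\beta)t(n)+\gamma n^2t(n-1),$$ $$(n+1)^3T(n+1)=-(2n+1)(\alpha n^2+\alpha n+\alpha-2\beta)T(n)-(\alpha^2+4\gamma)n^3T(n-1)$$ (for $n=0$ the last terms vanish), and put $$F(x)=\sum_{n\ge0}\binom{2n}{n}t(n)x^n,\qquad G(x)=\sum_{n\ge0}T(n)x^n.$$ Then $F_{6a},G_{6a}$ denote $F,G$ for $(\alpha,\beta,\gamma)=(-17,-6,-72)$; $F_{6b},G_{6b}$ denote $F,G$ for $(\alpha,\beta,\gamma)=(10,3,-9)$; and $F_{6c},G_{6c}$ denote $F,G$ for $(\alpha,\beta,\gamma)=(7,2,8)$. *)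

theory Defs
  imports "HOL-Complex_Analysis.Complex_Analysis"
begin

definition F1 :: "complex \<Rightarrow> complex" where
  "F1 x = (\<Sum>n. of_nat (((6*n) choose (3*n)) * ((3*n) choose (2*n)) * ((2*n) choose n)) * x ^ n)"

definition F2 :: "complex \<Rightarrow> complex" where
  "F2 x = (\<Sum>n. of_nat (((4*n) choose (2*n)) * ((2*n) choose n)^2) * x ^ n)"

definition F3 :: "complex \<Rightarrow> complex" where
  "F3 x = (\<Sum>n. of_nat (((3*n) choose n) * ((2*n) choose n)^2) * x ^ n)"

definition F4 :: "complex \<Rightarrow> complex" where
  "F4 x = (\<Sum>n. of_nat (((2*n) choose n)^3) * x ^ n)"

text \<open>
  Both sequences are given by three-term recurrences, here solved for the term of highest index.
  The last term of each recurrence vanishes at \<open>n = 0\<close> because of its factor \<open>n\<^sup>2\<close> or \<open>n\<^sup>3\<close>,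
  so the value of \<open>t (0 - 1)\<close>, where natural-number subtraction truncates, plays no role.
\<close>

fun t_seq :: "complex \<Rightarrow> complex \<Rightarrow> complex \<Rightarrow> nat \<Rightarrow> complex" where
  "t_seq \<alpha> \<beta> \<gamma> 0 = 1"
| "t_seq \<alpha> \<beta> \<gamma> (Suc n) =
     ((\<alpha> * of_nat n ^ 2 + \<alpha> * of_nat n + \<beta>) * t_seq \<alpha> \<beta> \<gamma> n
       + \<gamma> * of_nat n ^ 2 * t_seq \<alpha> \<beta> \<gamma> (n - 1))
     / (of_nat n + 1) ^ 2"

fun T_seq :: "complex \<Rightarrow> complex \<Rightarrow> complex \<Rightarrow> nat \<Rightarrow> complex" where
  "T_seq \<alpha> \<beta> \<gamma> 0 = 1"
| "T_seq \<alpha> \<beta> \<gamma> (Suc n) =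
     (- (2 * of_nat n + 1) * (\<alpha> * of_nat n ^ 2 + \<alpha> * of_nat n + \<alpha> - 2 * \<beta>) * T_seq \<alpha> \<beta> \<gamma> n
       - (\<alpha> ^ 2 + 4 * \<gamma>) * of_nat n ^ 3 * T_seq \<alpha> \<beta> \<gamma> (n - 1))
     / (of_nat n + 1) ^ 3"

definition F_ser :: "complex \<Rightarrow> complex \<Rightarrow> complex \<Rightarrow> complex \<Rightarrow> complex" where
  "F_ser \<alpha> \<beta> \<gamma> x = (\<Sum>n. of_nat ((2*n) choose n) * t_seq \<alpha> \<beta> \<gamma> n * x ^ n)"

definition G_ser :: "complex \<Rightarrow> complex \<Rightarrow> complex \<Rightarrow> complex \<Rightarrow> complex" where
  "G_ser \<alpha> \<beta> \<gamma> x = (\<Sum>n. T_seq \<alpha> \<beta> \<gamma> n * x ^ n)"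

definition F6a :: "complex \<Rightarrow> complex" where "F6a = F_ser (-17) (-6) (-72)"
definition G6a :: "complex \<Rightarrow> complex" where "G6a = G_ser (-17) (-6) (-72)"

definition F6b :: "complex \<Rightarrow> complex" where "F6b = F_ser 10 3 (-9)"
definition G6b :: "complex \<Rightarrow> complex" where "G6b = G_ser 10 3 (-9)"

definition F6c :: "complex \<Rightarrow> complex" where "F6c = F_ser 7 2 8"
definition G6c :: "complex \<Rightarrow> complex" where "G6c = G_ser 7 2 8"

text \<open>
  Every base of a fractional power below is a polynomial with constant term \<open>1\<close>.  Near \<open>p = 0\<close> it
  therefore avoids the negative real axis, so the principal branch computed by \<open>powr\<close> is
  the holomorphic branch that equals \<open>1\<close> at \<open>p = 0\<close>.
\<close>

definition level1_functions :: "(complex \<Rightarrow> complex) list" where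
  "level1_functions = [
    \<lambda>p. 1 / ((1+4*p-8*p^2) powr (1/2) * (1+228*p-408*p^2-128*p^3-192*p^4+768*p^5-512*p^6) powr (1/2))
      * F1 ((p*(1-p)^3*(1-4*p)^12*(1-2*p)*(1+2*p)^3)
          / ((1+4*p-8*p^2)^3*(1+228*p-408*p^2-128*p^3-192*p^4+768*p^5-512*p^6)^3)),
    \<lambda>p. 1 / ((1-2*p+4*p^2) powr (1/2) * (1-6*p+240*p^2-920*p^3+960*p^4-96*p^5+64*p^6) powr (1/2))
      * F1 ((p^2*(1-p)^6*(1-4*p)^6*(1-2*p)^2*(1+2*p)^6)
          / ((1-2*p+4*p^2)^3*(1-6*p+240*p^2-920*p^3+960*p^4-96*p^5+64*p^6)^3)),
    \<lambda>p. 1 / ((1+4*p-8*p^2) powr (1/2) * (1-12*p+72*p^2-128*p^3-192*p^4+768*p^5-512*p^6) powr (1/2))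
      * F1 ((p^3*(1-p)*(1-4*p)^4*(1-2*p)^3*(1+2*p))
          / ((1+4*p-8*p^2)^3*(1-12*p+72*p^2-128*p^3-192*p^4+768*p^5-512*p^6)^3)),
    \<lambda>p. 1 / ((1-2*p-2*p^2) powr (1/2) * (1-6*p+6*p^2+16*p^3+204*p^4-456*p^5-8*p^6) powr (1/2))
      * F1 ((p^4*(1-p)^12*(1-4*p)^3*(1-2*p)*(1+2*p)^3)
          / ((1-2*p-2*p^2)^3*(1-6*p+6*p^2+16*p^3+204*p^4-456*p^5-8*p^6)^3)),
    \<lambda>p. 1 / ((1-2*p+4*p^2) powr (1/2) * (1-6*p+40*p^3-96*p^5+64*p^6) powr (1/2))
      * F1 ((p^6*(1-p)^2*(1-4*p)^2*(1-2*p)^6*(1+2*p)^2)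
          / ((1-2*p+4*p^2)^3*(1-6*p+40*p^3-96*p^5+64*p^6)^3)),
    \<lambda>p. 1 / ((1-2*p-2*p^2) powr (1/2) * (1-6*p+6*p^2+16*p^3-36*p^4+24*p^5-8*p^6) powr (1/2))
      * F1 ((p^12*(1-p)^4*(1-4*p)*(1-2*p)^3*(1+2*p))
          / ((1-2*p-2*p^2)^3*(1-6*p+6*p^2+16*p^3-36*p^4+24*p^5-8*p^6)^3)),
    \<lambda>p. 1 / ((1-8*p+4*p^2) powr (1/2) * (1-240*p+1932*p^2-5888*p^3+7728*p^4-3840*p^5+64*p^6) powr (1/2))
      * F1 ((-p*(1-p)^3*(1-4*p)^3*(1-2*p)^4*(1+2*p)^12)
          / ((1-8*p+4*p^2)^3*(1-240*p+1932*p^2-5888*p^3+7728*p^4-3840*p^5+64*p^6)^3)),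
    \<lambda>p. 1 / ((1-8*p+4*p^2) powr (1/2) * (1+12*p^2-128*p^3+48*p^4+64*p^6) powr (1/2))
      * F1 ((-(p^3)*(1-p)*(1-4*p)*(1-2*p)^12*(1+2*p)^4)
          / ((1-8*p+4*p^2)^3*(1+12*p^2-128*p^3+48*p^4+64*p^6)^3))]"

definition level2_functions :: "(complex \<Rightarrow> complex) list" where
  "level2_functions = [
    \<lambda>p. 1 / (1+20*p-48*p^2+32*p^3-32*p^4)
      * F2 ((p*(1-p)^3*(1-4*p)^6*(1-2*p)*(1+2*p)^3) / (1+20*p-48*p^2+32*p^3-32*p^4)^4),
    \<lambda>p. 1 / (1-4*p+24*p^2-40*p^3-8*p^4)
      * F2 ((p^2*(1-p)^6*(1-4*p)^3*(1-2*p)*(1+2*p)^3) / (1-4*p+24*p^2-40*p^3-8*p^4)^4),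
    \<lambda>p. 1 / (1-4*p+32*p^3-32*p^4)
      * F2 ((p^3*(1-p)*(1-4*p)^2*(1-2*p)^3*(1+2*p)) / (1-4*p+32*p^3-32*p^4)^4),
    \<lambda>p. 1 / (1-4*p+8*p^3-8*p^4)
      * F2 ((p^6*(1-p)^2*(1-4*p)*(1-2*p)^3*(1+2*p)) / (1-4*p+8*p^3-8*p^4)^4),
    \<lambda>p. 1 / (1-28*p+96*p^2-112*p^3+16*p^4)
      * F2 (- ((p*(1-p)^3*(1-4*p)^3*(1-2*p)^2*(1+2*p)^6) / (1-28*p+96*p^2-112*p^3+16*p^4)^4)),
    \<lambda>p. 1 / (1-4*p-16*p^3+16*p^4)
      * F2 (- ((p^3*(1-p)*(1-4*p)*(1-2*p)^6*(1+2*p)^2) / (1-4*p-16*p^3+16*p^4)^4))]"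

definition level3_functions :: "(complex \<Rightarrow> complex) list" where
  "level3_functions = [
    \<lambda>p. 1 / (1+4*p-8*p^2)^2
      * F3 ((p*(1-p)*(1-4*p)^4*(1-4*p^2)) / (1+4*p-8*p^2)^6),
    \<lambda>p. 1 / (1-2*p+4*p^2)^2
      * F3 ((p^2*(1-p)^2*(1-4*p)^2*(1-4*p^2)^2) / (1-2*p+4*p^2)^6),
    \<lambda>p. 1 / (1-2*p-2*p^2)^2
      * F3 ((p^4*(1-p)^4*(1-4*p)*(1-4*p^2)) / (1-2*p-2*p^2)^6),
    \<lambda>p. 1 / (1-8*p+4*p^2)^2
      * F3 (- ((p*(1-p)*(1-4*p)*(1-4*p^2)^4) / (1-8*p+4*p^2)^6))]"

definition level4_functions :: "(complex \<Rightarrow> complex) list" where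
  "level4_functions = [
    \<lambda>p. 1 / ((1-2*p)*(1+2*p)^3)
      * F4 ((p*(1-p)^3*(1-4*p)^3) / ((1-2*p)^2*(1+2*p)^6)),
    \<lambda>p. 1 / ((1-2*p)^3*(1+2*p))
      * F4 ((p^3*(1-p)*(1-4*p)) / ((1-2*p)^6*(1+2*p)^2)),
    \<lambda>p. 1 / (1-4*p)^3
      * F4 (- ((p*(1-2*p)*(1+2*p)^3*(1-p)^3) / (1-4*p)^6)),
    \<lambda>p. 1 / (1-4*p)
      * F4 (- ((p^3*(1-2*p)^3*(1+2*p)*(1-p)) / (1-4*p)^2)),
    \<lambda>p. 1 / ((1-2*p) powr (1/2) * (1+2*p) powr (3/2) * (1-4*p) powr (3/2))
      * F4 (- ((p^2*(1-p)^6) / ((1-2*p)*(1+2*p)^3*(1-4*p)^3))),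
    \<lambda>p. 1 / ((1-2*p) powr (3/2) * (1+2*p) powr (1/2) * (1-4*p) powr (1/2))
      * F4 (- ((p^6*(1-p)^2) / ((1-2*p)^3*(1+2*p)*(1-4*p))))]"

definition level6_F_functions :: "(complex \<Rightarrow> complex) list" where
  "level6_F_functions = [
    \<lambda>p. 1 / (1-16*p+24*p^2+32*p^3-32*p^4)
      * F6a ((p*(1-p)*(1-4*p)^2*(1-2*p)*(1+2*p)) / (1-16*p+24*p^2+32*p^3-32*p^4)^2),
    \<lambda>p. 1 / (1-4*p-12*p^2+32*p^3-8*p^4)
      * F6a ((p^2*(1-p)^2*(1-4*p)*(1-2*p)*(1+2*p)) / (1-4*p-12*p^2+32*p^3-8*p^4)^2),
    \<lambda>p. 1 / (1+8*p-48*p^2+32*p^3+16*p^4)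
      * F6a ((-p*(1-p)*(1-4*p)*(1-2*p)^2*(1+2*p)^2) / (1+8*p-48*p^2+32*p^3+16*p^4)^2),
    \<lambda>p. 1 / ((1-2*p+4*p^2)*(1+4*p-8*p^2))
      * F6b ((p*(1-p)*(1-4*p)^2*(1-2*p)*(1+2*p)) / ((1-2*p+4*p^2)^2*(1+4*p-8*p^2)^2)),
    \<lambda>p. 1 / ((1-2*p-2*p^2)*(1-2*p+4*p^2))
      * F6b ((p^2*(1-p)^2*(1-4*p)*(1-2*p)*(1+2*p)) / ((1-2*p-2*p^2)^2*(1-2*p+4*p^2)^2)),
    \<lambda>p. 1 / ((1-2*p+4*p^2)*(1-8*p+4*p^2))
      * F6b ((-p*(1-p)*(1-4*p)*(1-2*p)^2*(1+2*p)^2) / ((1-2*p+4*p^2)^2*(1-8*p+4*p^2)^2)),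
    \<lambda>p. 1 / (1+8*p^2-32*p^3+32*p^4)
      * F6c ((p*(1-p)*(1-4*p)^2*(1-2*p)*(1+2*p)) / (1+8*p^2-32*p^3+32*p^4)^2),
    \<lambda>p. 1 / (1-4*p+4*p^2+8*p^4)
      * F6c ((p^2*(1-p)^2*(1-4*p)*(1-2*p)*(1+2*p)) / (1-4*p+4*p^2+8*p^4)^2),
    \<lambda>p. 1 / (1-8*p+32*p^2-32*p^3+16*p^4)
      * F6c ((-p*(1-p)*(1-4*p)*(1-2*p)^2*(1+2*p)^2) / (1-8*p+32*p^2-32*p^3+16*p^4)^2)]"

definition level6_G_functions :: "(complex \<Rightarrow> complex) list" where
  "level6_G_functions = [
    \<lambda>p. 1 / ((1+2*p)*(1-p))
      * G6a ((p*(1-4*p)^2*(1-2*p)) / ((1+2*p)*(1-p))),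
    \<lambda>p. 1 / ((1-2*p)*(1-p)^2)
      * G6a ((p^2*(1+2*p)*(1-4*p)) / ((1-2*p)*(1-p)^2)),
    \<lambda>p. 1 / ((1-p)*(1-4*p)*(1-2*p)^2)
      * G6a ((-p*(1+2*p)^2) / ((1-p)*(1-4*p)*(1-2*p)^2)),
    \<lambda>p. 1 / (1-4*p)^2
      * G6b ((p*(1+2*p)*(1-2*p)*(1-p)) / (1-4*p)^2),
    \<lambda>p. 1 / ((1-2*p)*(1+2*p)*(1-4*p))
      * G6b ((p^2*(1-p)^2) / ((1-2*p)*(1+2*p)*(1-4*p))),
    \<lambda>p. 1 / ((1-2*p)^2*(1+2*p)^2)
      * G6b ((-p*(1-p)*(1-4*p)) / ((1-2*p)^2*(1+2*p)^2)),
    \<lambda>p. 1 / ((1-p)*(1+2*p)*(1-4*p)^2)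
      * G6c ((p*(1-2*p)) / ((1-p)*(1+2*p)*(1-4*p)^2)),
    \<lambda>p. 1 / ((1+2*p)*(1-p)^2*(1-4*p))
      * G6c ((p^2*(1-2*p)) / ((1+2*p)*(1-p)^2*(1-4*p))),
    \<lambda>p. 1 / ((1-p)*(1-4*p)*(1+2*p)^2)
      * G6c ((-p*(1-2*p)^2) / ((1-p)*(1-4*p)*(1+2*p)^2))]"

definition all_functions :: "(complex \<Rightarrow> complex) list" where
  "all_functions = level1_functions @ level2_functions @ level3_functions @ level4_functions
     @ level6_F_functions @ level6_G_functions"

end

theory Submission
  imports Defs
begin

text \<open>
  In modular terms the forty-two functions are forty-two expressions for one form \<open>z\<close> of weight two: \<open>p\<close> is a
  coordinate on the modular curve of level 12 with modular parameter \<open>q\<close>, the argument \<open>x\<close> of each series is a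
  modular function of \<open>q\<^sup>k\<close> or of \<open>- q\<^sup>k\<close> for some \<open>k\<close> dividing 12, and the prefactor is the ratio of two forms of
  weight two. The proof replaces modularity by a differential equation in \<open>p\<close> which all the functions
  satisfy and which has only one solution that is analytic at \<open>0\<close> with value \<open>1\<close>.

  Each series \<open>Y\<close> satisfies a third-order equation, equivalent to its recurrence, which is the symmetric square
  of a second-order equation. Its first integral (\<open>ode_of_linear\<close>) is
  \<open>2 Y D\<^sup>2 Y - (D Y)\<^sup>2 = Q Y\<^sup>2\<close> with \<open>D = sqrt P * x d/dx\<close>, where \<open>P\<close> and \<open>Q\<close> are polynomials of degree at most two.
  Equations of this shape behave well under a change of variable \<open>x = x(p)\<close>: if \<open>V p d/dp\<close> corresponds to
  \<open>k M D\<close>, then \<open>f = Y(x) / M\<close> satisfies an equation of the same shape with \<open>V\<^sup>2\<close> in place of \<open>P\<close> and a new potential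
  \<open>W\<close> in place of \<open>Q\<close> (\<open>ode_pullback\<close>). This mirrors the fact that dividing \<open>q d/dq\<close> by a form of weight
  two gives an algebraic derivation. With \<open>B = M\<^sup>2\<close>, which is a polynomial in every case, the condition on the derivations
  comes down to \<open>P(x) B\<^sup>3\<close> being the square of a certain polynomial \<open>e\<close>, and the formula for \<open>W\<close> is another polynomial
  identity, of degree at most 24.

  For all forty-two functions \<open>V = (1 - p) (1 - 4 p) (1 - 2 p) (1 + 2 p)\<close> and \<open>W\<close> is the same polynomial of degree 8.
  Uniqueness (\<open>ode_unique\<close>) reflects that \<open>0\<close> is a point of maximally unipotent monodromy: solutions other
  than the analytic one involve logarithms. Hence all the functions have the same Taylor series at \<open>0\<close>.
\<close>

section \<open>The Euler operator on formal power series\<close>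

text \<open>
  The operator is written in terms of \<open>p d/dp\<close> because all equations below have a regular singular
  point at \<open>0\<close>: on coefficients \<open>theta\<close> is multiplication by the index.
\<close>
definition theta :: "complex fps \<Rightarrow> complex fps" where
  "theta F = fps_X * fps_deriv F"

lemma theta_nth [simp]: "fps_nth (theta F) n = of_nat n * fps_nth F n"
  by (cases n) (simp_all add: theta_def)

lemma theta_0 [simp]: "theta 0 = 0"
  and theta_1 [simp]: "theta 1 = 0"
  and theta_numeral [simp]: "theta (numeral c) = 0"
  and theta_of_int [simp]: "theta (of_int i) = 0"
  and theta_fps_X [simp]: "theta fps_X = fps_X"
  and theta_add [simp]: "theta (F + G) = theta F + theta G"
  and theta_diff [simp]: "theta (F - G) = theta F - theta G"
  and theta_uminus [simp]: "theta (- F) = - theta F"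
  by (simp_all add: theta_def algebra_simps)

lemma theta_mult [simp]: "theta (F * G) = theta F * G + F * theta G"
  by (simp add: theta_def algebra_simps)

lemma theta_power: "F * theta (F ^ n) = of_nat n * F ^ n * theta F"
  by (induction n) (simp_all add: algebra_simps)

lemma theta_power_numeral [simp]:
  "theta (F ^ numeral n) = numeral n * F ^ pred_numeral n * theta F"
proof -
  have "theta (F ^ m) = of_nat m * F ^ (m - 1) * theta F" for m
    by (induction m) (auto simp: algebra_simps power_eq_if)
  from this[of "numeral n"] show ?thesis by (simp only: pred_numeral_def of_nat_numeral)
qed

text \<open>
  The chain rule is \<open>x * theta (F oo x) = (theta F oo x) * theta x\<close>. Here the logarithmic derivative of \<open>x\<close>
  enters as the quotient \<open>s / r\<close>, so that nothing has to be divided by \<open>x\<close>.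
\<close>
lemma chain_theta:
  assumes "fps_nth x 0 = 0" "r * theta x = s * x"
  shows "r * theta (F oo x) = s * (theta F oo x)"
proof -
  have "theta (F oo x) = (fps_deriv F oo x) * theta x"
    using assms(1) by (simp add: theta_def fps_compose_deriv algebra_simps)
  moreover have "theta F oo x = x * (fps_deriv F oo x)"
    using assms(1) by (simp add: theta_def fps_compose_mult_distrib)
  moreover have "r * ((fps_deriv F oo x) * theta x) = (fps_deriv F oo x) * (r * theta x)"
    by (simp only: mult.left_commute)
  ultimately show ?thesis by (simp only: assms(2) ac_simps)
qed

section \<open>The equation for the square of a second-order solution\<close>

text \<open>
  With the derivation \<open>D = sqrt P * theta\<close>, whose square \<open>D\<^sup>2 Y = P * theta (theta Y) + theta P * theta Y / 2\<close> is free
  of square roots, the equation reads \<open>2 Y D\<^sup>2 Y - (D Y)\<^sup>2 = Q Y\<^sup>2\<close>. For \<open>Y = u\<^sup>2\<close> it says \<open>4 D\<^sup>2 u = Q u\<close>: it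
  characterises the squares of solutions of a second-order linear equation, as in Clausen's formula.
\<close>
definition ode :: "complex fps \<Rightarrow> complex fps \<Rightarrow> complex fps \<Rightarrow> bool" where
  "ode P Q Y \<longleftrightarrow> Y * (2 * P * theta (theta Y) + theta P * theta Y) = P * (theta Y)\<^sup>2 + Q * Y\<^sup>2"

text \<open>
  The third-order operator is the symmetric square of \<open>4 D\<^sup>2 u = Q u\<close>. The difference \<open>I\<close> of the two sides of
  \<open>ode\<close> satisfies \<open>theta I = Y * (third-order operator applied to Y)\<close>, so \<open>I\<close> is a constant; the constant
  vanishes because \<open>theta\<close> kills constant terms and \<open>Q\<close> has none.
\<close>
lemma ode_of_linear:
  assumes lin: "2 * P * theta (theta (theta Y)) + 3 * theta P * theta (theta Y)
                  + (theta (theta P) - 2 * Q) * theta Y - theta Q * Y = 0"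
    and Q0: "fps_nth Q 0 = 0"
  shows "ode P Q Y"
proof -
  define I where "I = Y * (2 * P * theta (theta Y) + theta P * theta Y) - P * (theta Y)\<^sup>2 - Q * Y\<^sup>2"
  have "theta I = Y * (2 * P * theta (theta (theta Y)) + 3 * theta P * theta (theta Y)
                  + (theta (theta P) - 2 * Q) * theta Y - theta Q * Y)"
    unfolding I_def theta_add theta_diff theta_mult theta_numeral theta_power_numeral
    by (simp add: algebra_simps power2_eq_square)
  then have I': "theta I = 0" by (simp add: lin)
  have "fps_nth I n = 0" for n
  proof (cases "n = 0")
    case True
    then show ?thesis using Q0 by (simp add: I_def fps_mult_nth_0 power2_eq_square)
  next
    case False
    have "of_nat n * fps_nth I n = 0" using arg_cong[OF I', of "\<lambda>F. fps_nth F n"] by simp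
    with False show ?thesis by simp
  qed
  then have "I = 0" by (simp add: fps_eq_iff)
  then show ?thesis by (simp add: ode_def I_def algebra_simps)
qed

lemma fps_nth_mult_lowest:
  fixes F G :: "complex fps"
  assumes "\<And>i. i < n \<Longrightarrow> fps_nth F i = 0"
  shows "fps_nth (G * F) n = fps_nth G 0 * fps_nth F n"
proof -
  have "fps_nth (G * F) n = (\<Sum>i\<in>{0..n}. if i = 0 then fps_nth G 0 * fps_nth F n else 0)"
    unfolding fps_mult_nth by (rule sum.cong) (auto simp: assms)
  then show ?thesis by simp
qed

text \<open>
  The equation is quadratic in \<open>Y\<close>, so the difference of two solutions is governed by the polarised form
  evaluated at \<open>d = F - G\<close> and \<open>s = F + G\<close>. If \<open>n > 0\<close> is the order of \<open>d\<close>, the only term contributing to the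
  coefficient of index \<open>n\<close> is \<open>2 s P * theta (theta d)\<close>, with value \<open>4 n\<^sup>2\<close> times the coefficient of \<open>d\<close>.
\<close>
lemma ode_unique:
  assumes F: "ode P Q F" "fps_nth F 0 = 1" and G: "ode P Q G" "fps_nth G 0 = 1"
    and P0: "fps_nth P 0 = 1" and Q0: "fps_nth Q 0 = 0"
  shows "F = G"
proof -
  define d s where "d = F - G" and "s = F + G"
  have bil: "(s * 2 * P) * theta (theta d) + (s * theta P - 2 * P * theta s) * theta d
     + (2 * P * theta (theta s) + theta P * theta s - 2 * Q * s) * d = 0" (is "?L = 0")
  proof -
    have "?L = 2 * (F * (2 * P * theta (theta F) + theta P * theta F) - P * (theta F)\<^sup>2 - Q * F\<^sup>2)
             - 2 * (G * (2 * P * theta (theta G) + theta P * theta G) - P * (theta G)\<^sup>2 - Q * G\<^sup>2)"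
      unfolding d_def s_def theta_add theta_diff by (simp add: algebra_simps power2_eq_square)
    then show ?thesis using F(1) G(1) by (simp add: ode_def)
  qed
  have s0: "fps_nth s 0 = 2" using F G by (simp add: s_def)
  have "fps_nth d n = 0" for n
  proof (induction n rule: less_induct)
    case (less n)
    show ?case
    proof (cases "n = 0")
      case True
      then show ?thesis using F G by (simp add: d_def)
    next
      case False
      have "fps_nth ((s * 2 * P) * theta (theta d) + (s * theta P - 2 * P * theta s) * theta d
         + (2 * P * theta (theta s) + theta P * theta s - 2 * Q * s) * d) n = 4 * of_nat n ^ 2 * fps_nth d n"
        using less.IH unfolding fps_add_nth
        by (subst (1 2 3) fps_nth_mult_lowest) (simp_all add: s0 P0 Q0 fps_mult_nth_0 power2_eq_square)
      then show ?thesis using False by (simp add: bil)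
    qed
  qed
  then have "d = 0" by (simp add: fps_eq_iff)
  then show ?thesis by (simp add: d_def)
qed

section \<open>Change of variable\<close>

text \<open>
  The algebra behind the change of variable. Here \<open>y, y1, y2\<close> stand for \<open>Y, theta Y, theta\<^sup>2 Y\<close> composed with
  \<open>x\<close>, and \<open>p, p1, q\<close> for \<open>P, theta P, Q\<close> composed with \<open>x\<close>, while \<open>g, Dg, m, Dm, de\<close> are the images of \<open>f, g, B, m, e\<close>
  under the derivation \<open>V * theta\<close>. Each equation is obtained by exhibiting it as a combination of the
  hypotheses.
\<close>
lemma ode_pullback_aux:
  fixes f g m y y1 y2 p p1 q e de k B M Dg W Dm :: "'a::idom"
  assumes ode: "y * (2 * p * y2 + p1 * y1) = p * y1^2 + q * y^2"
    and B: "M * M = B" and f: "f * M = y"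
    and g: "2 * B^2 * g = 2 * k * e * M * y1 - B * f * m"
    and pB: "p * B^3 = e^2" and p1B: "k * p1 * B^3 = 2 * B * de - 3 * e * m"
    and Dg: "2 * B^3 * Dg = -5 * B^2 * m * g + k * M * y1 * (2 * B * de + e * m) + 2 * k^2 * e^2 * M * y2
                  - B * f * m^2 - B^2 * f * Dm"
    and q: "4 * k^2 * q * B^3 = 4 * W * B^2 + 4 * B * Dm - 5 * m^2"
  shows "4 * B^4 * (2 * f * Dg) = 4 * B^4 * (g^2 + W * f^2)"
proof -
  have e1: "2 * k^2 * e^2 * y * y2
      = k^2 * e^2 * y1^2 + k^2 * q * B^3 * y^2 - k * y * y1 * (2 * B * de - 3 * e * m)" (is "?l1 = ?r1")
  proof -
    have "?l1 - ?r1 = k^2 * B^3 * (y * (2 * p * y2 + p1 * y1) - (p * y1^2 + q * y^2))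
        + k^2 * (y1^2 - 2 * y * y2) * (p * B^3 - e^2) - k * y * y1 * (k * p1 * B^3 - (2 * B * de - 3 * e * m))"
      by algebra
    then show ?thesis by (simp add: ode pB p1B)
  qed
  have e2: "2 * f * B^3 * Dg = -5 * B^2 * m * f * g + k * y * y1 * (2 * B * de + e * m) + 2 * k^2 * e^2 * y * y2
                  - B * f^2 * m^2 - B^2 * f^2 * Dm" (is "?l2 = ?r2")
  proof -
    have "?l2 - ?r2 = f * (2 * B^3 * Dg - (-5 * B^2 * m * g + k * M * y1 * (2 * B * de + e * m)
            + 2 * k^2 * e^2 * M * y2 - B * f * m^2 - B^2 * f * Dm))
        + (k * y1 * (2 * B * de + e * m) + 2 * k^2 * e^2 * y2) * (f * M - y)"
      by algebra
    then show ?thesis by (simp add: Dg f)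
  qed
  have e3: "2 * k * e * y * y1 = 2 * B^2 * f * g + B * f^2 * m" (is "?l3 = ?r3")
  proof -
    have "?l3 - ?r3 = 2 * k * e * y1 * (y - f * M) - f * (2 * B^2 * g - (2 * k * e * M * y1 - B * f * m))"
      by algebra
    then show ?thesis by (simp add: g f)
  qed
  have e4: "4 * k^2 * e^2 * y1^2 * B = (2 * B^2 * g + B * f * m)^2" (is "?l4 = ?r4")
  proof -
    have "?l4 - ?r4 = (2 * k * e * M * y1 - B * f * m - 2 * B^2 * g) * (2 * k * e * M * y1 + B * f * m + 2 * B^2 * g)
        - 4 * k^2 * e^2 * y1^2 * (M * M - B)"
      by algebra
    then show ?thesis by (simp add: g B)
  qed
  have e5: "y^2 = B * f^2" using f B by (metis mult.commute power2_eq_square power_mult_distrib)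
  let ?R = "4 * B^4 * (g^2 + W * f^2)"
  have "4 * B^4 * (2 * f * Dg) - ?R = 4 * B * (?l2 - ?r2) + 4 * B * (?l1 - ?r1) + 8 * B * m * (?l3 - ?r3)
      + (?l4 - ?r4) + 4 * k^2 * q * B^4 * (y^2 - B * f^2)
      + B^2 * f^2 * (4 * k^2 * q * B^3 - (4 * W * B^2 + 4 * B * Dm - 5 * m^2))"
    by algebra
  then show ?thesis unfolding e1 e2 e3 e4 e5 q by simp
qed

text \<open>
  A Liouville transformation. The hypotheses on \<open>x\<close> and \<open>P\<close> say that the derivation \<open>V * theta\<close> in the new
  variable corresponds to \<open>k M D\<close>, where \<open>D = sqrt P * theta\<close> in the old one: \<open>e\<close> is the square root of
  \<open>P(x) B\<^sup>3\<close>, and \<open>k e / (B V)\<close> is the logarithmic derivative of \<open>x\<close>. Dividing the solution by the same factor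
  \<open>M\<close> that rescales the derivation makes all terms with first derivatives of \<open>f\<close> cancel, so \<open>f\<close> satisfies an
  equation of the same shape; the last hypothesis is the resulting formula for its potential \<open>W\<close>. Only
  \<open>B = M\<^sup>2\<close> enters, which is why \<open>M\<close> may involve square roots.
\<close>
lemma ode_pullback:
  fixes k :: int
  assumes Y: "ode P Q Y" and x0: "fps_nth x 0 = 0"
    and M: "M * M = B" and f: "f * M = Y oo x"
    and nz: "V \<noteq> 0" "B \<noteq> 0" "e \<noteq> 0"
    and dx: "B * V * theta x = of_int k * e * x"
    and P: "(P oo x) * B^3 = e^2"
    and Q: "4 * of_int k^2 * (Q oo x) * B^3
        = 4 * W * B^2 + 4 * B * V * theta (V * theta B) - 5 * (V * theta B)^2"
  shows "ode (V^2) W f"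
proof -
  let ?k = "of_int k :: complex fps"
  define y y1 y2 where "y = Y oo x" and "y1 = theta Y oo x" and "y2 = theta (theta Y) oo x"
  define p p1 where "p = P oo x" and "p1 = theta P oo x"
  define m g de Dg where "m = V * theta B" and "g = V * theta f" and "de = V * theta e"
    and "Dg = V * theta g"
  have comp: "y * (2 * p * y2 + p1 * y1) = p * y1^2 + (Q oo x) * y^2"
    using arg_cong[OF Y[unfolded ode_def], of "\<lambda>F. F oo x"] x0
    by (simp add: y_def y1_def y2_def p_def p1_def fps_compose_mult_distrib fps_compose_add_distrib
        fps_compose_power power2_eq_square)
  have dy: "B * V * theta y = ?k * e * y1" and dy1: "B * V * theta y1 = ?k * e * y2"
    and dp: "B * V * theta p = ?k * e * p1"
    unfolding y_def y1_def y2_def p_def p1_def by (rule chain_theta[OF x0 dx])+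
  have mM: "m = 2 * M * (V * theta M)" by (simp add: m_def flip: M)
  have p1B: "?k * p1 * B^3 = 2 * B * de - 3 * e * m"
  proof -
    have "theta (p * B^3) = theta (e^2)" using P by (simp add: p_def)
    then have t: "theta p * B^3 + 3 * p * B^2 * theta B = 2 * e * theta e"
      by (simp add: algebra_simps)
    have "e * (?k * p1 * B^3) = B * V * (theta p * B^3 + 3 * p * B^2 * theta B) - 3 * m * (p * B^3)"
      unfolding m_def using dp by (simp add: algebra_simps power2_eq_square power3_eq_cube)
    also have "\<dots> = e * (2 * B * de - 3 * e * m)"
      unfolding t P[folded p_def] de_def by (simp add: algebra_simps power2_eq_square)
    finally show ?thesis using nz by simp
  qed
  have g1: "2 * B^2 * g = 2 * ?k * e * M * y1 - B * f * m"
  proof -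
    have "theta f * M + f * theta M = theta y" using f by (simp add: y_def flip: theta_mult)
    then have "2 * M * (B * V * (theta f * M + f * theta M)) = 2 * M * (?k * e * y1)" by (simp add: dy)
    then show ?thesis unfolding mM M[symmetric] g_def by (simp add: algebra_simps power2_eq_square)
  qed
  have Dg: "2 * B^3 * Dg = -5 * B^2 * m * g + ?k * M * y1 * (2 * B * de + e * m) + 2 * ?k^2 * e^2 * M * y2
                  - B * f * m^2 - B^2 * f * (V * theta m)"
  proof -
    have "B * V * theta (2 * B^2 * g) = B * V * theta (2 * ?k * e * M * y1 - B * f * m)" by (simp only: g1)
    then have "4 * B^2 * m * g + 2 * B^3 * Dg = 2 * ?k * B * de * M * y1 + 2 * ?k * e * M * (M * (V * theta M)) * y1
        + 2 * ?k * e * M * (B * V * theta y1) - B * f * m^2 - B^2 * g * m - B^2 * f * (V * theta m)"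
      unfolding de_def Dg_def g_def m_def M[symmetric]
      by (simp add: algebra_simps power2_eq_square power3_eq_cube)
    then show ?thesis unfolding dy1 mM by (simp add: algebra_simps power2_eq_square power3_eq_cube)
  qed
  have "4 * B^4 * (2 * f * Dg) = 4 * B^4 * (g^2 + W * f^2)"
    by (rule ode_pullback_aux[OF comp M f[folded y_def] g1 _ p1B Dg])
       (use P Q in \<open>simp_all add: p_def m_def mult.assoc\<close>)
  moreover have "4 * B^4 \<noteq> 0" using nz by simp
  ultimately have "2 * f * Dg = g^2 + W * f^2" using mult_left_cancel by blast
  then show ?thesis unfolding ode_def Dg_def g_def by (simp add: algebra_simps power2_eq_square)
qed

section \<open>Analytic solutions near the origin\<close>

text \<open>
  The normalisation at \<open>0\<close> is built in, so that two functions with this property for the same \<open>P\<close> and \<open>Q\<close>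
  agree near \<open>0\<close>.
\<close>
definition satisfies :: "complex fps \<Rightarrow> complex fps \<Rightarrow> (complex \<Rightarrow> complex) \<Rightarrow> bool" where
  "satisfies P Q f \<longleftrightarrow> (\<exists>Y. f has_fps_expansion Y \<and> fps_nth Y 0 = 1 \<and> ode P Q Y)"

lemma satisfies_unique:
  assumes "satisfies P Q f" "satisfies P Q g" "fps_nth P 0 = 1" "fps_nth Q 0 = 0"
  shows "eventually (\<lambda>p. f p = g p) (nhds 0)"
proof -
  from assms(1,2) obtain F G where F: "f has_fps_expansion F" "fps_nth F 0 = 1" "ode P Q F"
    and G: "g has_fps_expansion G" "fps_nth G 0 = 1" "ode P Q G"
    unfolding satisfies_def by blast
  have "F = G" using F G assms by (intro ode_unique[of P Q]) auto
  then have "(\<lambda>p. f p - g p) has_fps_expansion 0"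
    using has_fps_expansion_diff[OF F(1) G(1)] by simp
  then show ?thesis by (simp add: has_fps_expansion_0_iff)
qed

abbreviation quadP :: "int \<Rightarrow> int \<Rightarrow> complex fps" where
  "quadP p1 p2 \<equiv> 1 + of_int p1 * fps_X + of_int p2 * fps_X^2"

abbreviation quadQ :: "int \<Rightarrow> int \<Rightarrow> complex fps" where
  "quadQ q1 q2 \<equiv> of_int q1 * fps_X + of_int q2 * fps_X^2"

lemma of_int_mult_nth: "fps_nth (of_int c * F) n = of_int c * fps_nth (F::complex fps) n"
  by (simp flip: fps_of_int)

text \<open>
  A crude geometric bound suffices: it gives a positive radius of convergence. Dividing the recurrence by its
  leading factor \<open>2 (n + 1)\<^sup>3\<close> leaves coefficients bounded by \<open>\<bar>p1\<bar> + \<bar>q1\<bar>\<close> and \<open>\<bar>p2\<bar> + \<bar>q2\<bar>\<close>.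
\<close>
lemma recurrence_bound:
  fixes a :: "nat \<Rightarrow> complex" and p1 p2 q1 q2 :: int
  assumes a0: "a 0 = 1"
    and rec: "\<And>n. 2 * (of_nat n + 1)^3 * a (Suc n)
        = - (2 * of_nat n + 1) * (of_int p1 * of_nat n * (of_nat n + 1) - of_int q1) * a n
          - 2 * of_nat n * (of_int p2 * (of_nat n^2 - 1) - of_int q2) * a (n - 1)"
  shows "cmod (a n) \<le> (1 + \<bar>real_of_int p1\<bar> + \<bar>real_of_int q1\<bar> + \<bar>real_of_int p2\<bar> + \<bar>real_of_int q2\<bar> :: real) ^ n"
proof (induction n rule: less_induct)
  case (less n)
  define K where "K = (1 + \<bar>real_of_int p1\<bar> + \<bar>real_of_int q1\<bar> + \<bar>real_of_int p2\<bar> + \<bar>real_of_int q2\<bar>)"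
  have K1: "K \<ge> 1" by (simp add: K_def)
  show ?case
  proof (cases n)
    case 0
    then show ?thesis by (simp add: a0)
  next
    case (Suc m)
    define x where "x = real m"
    have x: "x \<ge> 0" by (simp add: x_def)
    have am: "cmod (a m) \<le> K ^ m" using less.IH[of m] Suc by (simp add: K_def)
    have "cmod (a (m - 1)) \<le> K ^ (m - 1)" using less.IH[of "m - 1"] Suc by (simp add: K_def)
    also have "\<dots> \<le> K ^ m" using K1 by (intro power_increasing) auto
    finally have am1: "cmod (a (m - 1)) \<le> K ^ m" .
    have c1: "cmod (of_int p1 * of_nat m * (of_nat m + 1) - of_int q1 :: complex) \<le> (\<bar>real_of_int p1\<bar> + \<bar>real_of_int q1\<bar>) * (x + 1)^2"
    proof -
      have "cmod (of_int p1 * of_nat m * (of_nat m + 1) - of_int q1 :: complex)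
          \<le> cmod (of_int p1 * of_nat m * (of_nat m + 1) :: complex) + cmod (of_int q1 :: complex)"
        by (rule norm_triangle_ineq4)
      also have "\<dots> = \<bar>real_of_int p1\<bar> * (x * (x + 1)) + \<bar>real_of_int q1\<bar> * 1"
        using norm_of_nat[of "Suc m", where ?'a = complex] by (simp add: norm_mult x_def add.commute)
      also have "\<dots> \<le> \<bar>real_of_int p1\<bar> * (x + 1)^2 + \<bar>real_of_int q1\<bar> * (x + 1)^2"
        using x by (intro add_mono mult_left_mono) (auto simp: power2_eq_square algebra_simps)
      finally show ?thesis by (simp add: algebra_simps)
    qed
    have c2: "cmod (of_int p2 * (of_nat m^2 - 1) - of_int q2 :: complex) \<le> (\<bar>real_of_int p2\<bar> + \<bar>real_of_int q2\<bar>) * (x + 1)^2"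
    proof -
      have "cmod (of_int p2 * (of_nat m^2 - 1) - of_int q2 :: complex)
          \<le> cmod (of_int p2 * (of_nat m^2 - 1) :: complex) + cmod (of_int q2 :: complex)"
        by (rule norm_triangle_ineq4)
      also have "\<dots> \<le> \<bar>real_of_int p2\<bar> * (cmod (of_nat m^2 :: complex) + cmod (1 :: complex)) + \<bar>real_of_int q2\<bar> * 1"
        unfolding norm_mult by (intro add_mono mult_mono norm_triangle_ineq4) auto
      also have "\<dots> \<le> \<bar>real_of_int p2\<bar> * (x + 1)^2 + \<bar>real_of_int q2\<bar> * (x + 1)^2"
        using x by (intro add_mono mult_left_mono) (auto simp: power2_eq_square algebra_simps x_def norm_mult)
      finally show ?thesis by (simp add: algebra_simps)
    qed
    have n1: "cmod (2 * of_nat m + 1 :: complex) \<le> 2 * (x + 1)"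
      using norm_triangle_ineq[of "2 * of_nat m :: complex" 1] by (simp add: norm_mult x_def)
    have n2: "cmod (2 * of_nat m :: complex) \<le> 2 * (x + 1)" by (simp add: norm_mult x_def)
    have n3: "cmod (of_nat m + 1 :: complex) = x + 1"
      using norm_of_nat[of "Suc m", where ?'a = complex] by (simp add: x_def add.commute)
    have "2 * (x + 1)^3 * cmod (a n) = cmod (2 * (of_nat m + 1)^3 * a (Suc m))"
      by (simp add: norm_mult norm_power n3 Suc)
    also have "\<dots> \<le> cmod (- (2 * of_nat m + 1) * (of_int p1 * of_nat m * (of_nat m + 1) - of_int q1) * a m)
        + cmod (2 * of_nat m * (of_int p2 * (of_nat m^2 - 1) - of_int q2) * a (m - 1))"
      unfolding rec by (rule norm_triangle_ineq4)
    also have "\<dots> \<le> 2 * (x + 1) * ((\<bar>real_of_int p1\<bar> + \<bar>real_of_int q1\<bar>) * (x + 1)^2) * K ^ m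
        + 2 * (x + 1) * ((\<bar>real_of_int p2\<bar> + \<bar>real_of_int q2\<bar>) * (x + 1)^2) * K ^ m"
      unfolding norm_mult norm_minus_cancel
      using c1 c2 n1 n2 am am1 x K1
      by (intro add_mono mult_mono) (auto simp: norm_mult)
    also have "\<dots> = 2 * (x + 1)^3 * ((K - 1) * K ^ m)"
      by (simp add: K_def algebra_simps power2_eq_square power3_eq_cube)
    also have "\<dots> \<le> 2 * (x + 1)^3 * K ^ n"
      using x K1 Suc by (intro mult_left_mono) (auto intro!: mult_right_mono)
    finally have "cmod (a n) \<le> K ^ n" using x by (simp add: mult_le_cancel_left_pos)
    then show ?thesis by (simp add: K_def)
  qed
qed

text \<open>
  The recurrence is the coefficientwise form of the third-order equation in \<open>ode_of_linear\<close> for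
  \<open>P = 1 + p1 x + p2 x\<^sup>2\<close> and \<open>Q = q1 x + q2 x\<^sup>2\<close>. All power series of the theorem are of this kind.
\<close>
lemma satisfies_of_recurrence:
  fixes a :: "nat \<Rightarrow> complex" and p1 p2 q1 q2 :: int
  assumes a0: "a 0 = 1"
    and rec: "\<And>n. 2 * (of_nat n + 1)^3 * a (Suc n)
        = - (2 * of_nat n + 1) * (of_int p1 * of_nat n * (of_nat n + 1) - of_int q1) * a n
          - 2 * of_nat n * (of_int p2 * (of_nat n^2 - 1) - of_int q2) * a (n - 1)"
  shows "satisfies (quadP p1 p2) (quadQ q1 q2) (\<lambda>x. \<Sum>n. a n * x ^ n)"
proof -
  define Y where "Y = Abs_fps a"
  have nth: "fps_nth Y n = a n" for n by (simp add: Y_def)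
  define K where "K = (1 + \<bar>real_of_int p1\<bar> + \<bar>real_of_int q1\<bar> + \<bar>real_of_int p2\<bar> + \<bar>real_of_int q2\<bar>)"
  have K1: "K \<ge> 1" by (simp add: K_def)
  have bound: "cmod (a n) \<le> K ^ n" for n
    using recurrence_bound[OF a0 rec, of n] by (simp add: K_def)
  have "summable (\<lambda>n. a n * of_real (1 / (2 * K)) ^ n)"
  proof (rule summable_comparison_test'[where N = 0])
    show "summable (\<lambda>n. (1 / 2 :: real) ^ n)" by (simp add: summable_geometric)
    show "cmod (a n * of_real (1 / (2 * K)) ^ n) \<le> (1 / 2) ^ n" for n
    proof -
      have "cmod (a n * of_real (1 / (2 * K)) ^ n) = cmod (a n) * (1 / (2 * K)) ^ n"
        using K1 by (simp add: norm_mult norm_power norm_divide)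
      also have "\<dots> \<le> K ^ n * (1 / (2 * K)) ^ n"
        using K1 bound by (intro mult_right_mono) auto
      also have "\<dots> = (1 / 2) ^ n" using K1 by (simp flip: power_mult_distrib)
      finally show ?thesis .
    qed
  qed
  then have "conv_radius a \<ge> cmod (of_real (1 / (2 * K)) :: complex)"
    by (rule conv_radius_geI)
  moreover have "cmod (of_real (1 / (2 * K)) :: complex) > 0" using K1 by simp
  ultimately have "fps_conv_radius Y > 0"
    unfolding fps_conv_radius_def Y_def by (simp add: order_less_le_trans[rotated])
  then have "eval_fps Y has_fps_expansion Y" by (rule eval_fps_has_fps_expansion)
  moreover have "eval_fps Y = (\<lambda>x. \<Sum>n. a n * x ^ n)" by (simp add: eval_fps_def nth fun_eq_iff)
  moreover have "ode (quadP p1 p2) (quadQ q1 q2) Y"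
  proof (rule ode_of_linear)
    let ?P = "quadP p1 p2" and ?Q = "quadQ q1 q2"
    let ?L = "2 * ?P * theta (theta (theta Y)) + 3 * theta ?P * theta (theta Y)
                  + (theta (theta ?P) - 2 * ?Q) * theta Y - theta ?Q * Y"
    have L: "?L = 2 * theta (theta (theta Y))
        + fps_X * (of_int p1 * (2 * theta (theta (theta Y)) + 3 * theta (theta Y) + theta Y)
                   - of_int q1 * (2 * theta Y + Y))
        + fps_X * (fps_X * (of_int p2 * (2 * theta (theta (theta Y)) + 6 * theta (theta Y) + 4 * theta Y)
                   - of_int q2 * (2 * theta Y + 2 * Y)))"
      by (simp add: algebra_simps power2_eq_square)
    note coeffs = fps_add_nth fps_sub_nth fps_mult_numeral_left of_int_mult_nth theta_nth fps_X_mult_nth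
      nth nat.simps diff_Suc_1 if_False if_True
    have "fps_nth ?L n = 0" for n
    proof (cases n)
      case 0
      then show ?thesis unfolding L by simp
    next
      case (Suc m)
      have "fps_nth ?L n = 2 * (of_nat m + 1)^3 * a (Suc m)
        - (- (2 * of_nat m + 1) * (of_int p1 * of_nat m * (of_nat m + 1) - of_int q1) * a m
          - 2 * of_nat m * (of_int p2 * (of_nat m^2 - 1) - of_int q2) * a (m - 1))"
      proof (cases m)
        case 0
        then show ?thesis unfolding L Suc
          by (simp only: coeffs) (simp add: algebra_simps)
      next
        case (Suc l)
        then show ?thesis unfolding L \<open>n = Suc m\<close> Suc
          by (simp only: coeffs) (simp add: algebra_simps power2_eq_square power3_eq_cube)
      qed
      then show ?thesis by (simp add: rec)
    qed
    then show "?L = 0" by (simp add: fps_eq_iff)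
  qed (simp add: of_int_mult_nth)
  ultimately show ?thesis unfolding satisfies_def using a0 nth by metis
qed

section \<open>The power series of the theorem\<close>

lemma of_nat_plus_1_neq_0: "(of_nat n + 1 :: complex) \<noteq> 0"
  using of_nat_neq_0[of n, where ?'a = complex] by (simp add: add.commute)

lemma satisfies_hypergeometric:
  fixes a :: "nat \<Rightarrow> complex" and \<kappa> q :: int
  assumes "a 0 = 1"
    and "\<And>n. 2 * (of_nat n + 1)^3 * a (Suc n) = (2 * of_nat n + 1) * (of_int \<kappa> * of_nat n * (of_nat n + 1) + of_int q) * a n"
  shows "satisfies (quadP (-\<kappa>) 0) (quadQ q 0) (\<lambda>x. \<Sum>n. a n * x ^ n)"
  using assms by (intro satisfies_of_recurrence) (simp_all add: algebra_simps)

lemma fact_mult_Suc: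
  "fact (Suc n) = (of_nat n + 1) * (fact n :: complex)"
  "fact (2 * Suc n) = (2 * of_nat n + 2) * (2 * of_nat n + 1) * (fact (2 * n) :: complex)"
  "fact (3 * Suc n) = (3 * of_nat n + 3) * (3 * of_nat n + 2) * (3 * of_nat n + 1) * (fact (3 * n) :: complex)"
  "fact (4 * Suc n) = (4 * of_nat n + 4) * (4 * of_nat n + 3) * (4 * of_nat n + 2) * (4 * of_nat n + 1)
     * (fact (4 * n) :: complex)"
  "fact (6 * Suc n) = (6 * of_nat n + 6) * (6 * of_nat n + 5) * (6 * of_nat n + 4) * (6 * of_nat n + 3)
     * (6 * of_nat n + 2) * (6 * of_nat n + 1) * (fact (6 * n) :: complex)"
proof -
  have "2 * Suc n = Suc (Suc (2*n))" "3 * Suc n = Suc (Suc (Suc (3*n)))"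
    "4 * Suc n = Suc (Suc (Suc (Suc (4*n))))" "6 * Suc n = Suc (Suc (Suc (Suc (Suc (Suc (6*n))))))"
    by simp_all
  note Suc = this
  show "fact (Suc n) = (of_nat n + 1) * (fact n :: complex)" by (simp add: add.commute)
  show "fact (2 * Suc n) = (2 * of_nat n + 2) * (2 * of_nat n + 1) * (fact (2 * n) :: complex)"
    unfolding Suc fact_Suc by (simp add: add_ac mult_ac)
  show "fact (3 * Suc n) = (3 * of_nat n + 3) * (3 * of_nat n + 2) * (3 * of_nat n + 1) * (fact (3 * n) :: complex)"
    unfolding Suc fact_Suc by (simp add: add_ac mult_ac)
  show "fact (4 * Suc n) = (4 * of_nat n + 4) * (4 * of_nat n + 3) * (4 * of_nat n + 2) * (4 * of_nat n + 1)
     * (fact (4 * n) :: complex)"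
    unfolding Suc fact_Suc by (simp add: add_ac mult_ac)
  show "fact (6 * Suc n) = (6 * of_nat n + 6) * (6 * of_nat n + 5) * (6 * of_nat n + 4) * (6 * of_nat n + 3)
     * (6 * of_nat n + 2) * (6 * of_nat n + 1) * (fact (6 * n) :: complex)"
    unfolding Suc fact_Suc by (simp add: add_ac mult_ac)
qed

lemma quotient_step:
  fixes a0 a1 :: "'a::idom"
  assumes "N = a0 * D" "u * r * N = a1 * (u * s * D)" "u \<noteq> 0" "D \<noteq> 0"
  shows "s * a1 = r * a0"
proof -
  have "(u * D) * (s * a1) = u * r * N" unfolding assms(2) by (simp only: ac_simps)
  also have "\<dots> = (u * D) * (r * a0)" by (simp add: assms(1) ac_simps)
  finally show ?thesis using assms(3,4) by simp
qed

text \<open>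
  The products of binomial coefficients are quotients of factorials, and the common factor \<open>u\<close> of numerator
  and denominator cancels in the ratio of consecutive terms.
\<close>
lemma satisfies_factorial_quotient:
  fixes a N D u r :: "nat \<Rightarrow> complex" and \<kappa> q :: int
  assumes "a 0 = 1" and a: "\<And>n. N n = a n * D n" and D: "\<And>n. D n \<noteq> 0" and u: "\<And>n. u n \<noteq> 0"
    and N_Suc: "\<And>n. N (Suc n) = u n * r n * N n"
    and D_Suc: "\<And>n. D (Suc n) = u n * (of_nat n + 1)^3 * D n"
    and r: "\<And>n. 2 * r n = (2 * of_nat n + 1) * (of_int \<kappa> * of_nat n * (of_nat n + 1) + of_int q)"
  shows "satisfies (quadP (-\<kappa>) 0) (quadQ q 0) (\<lambda>x. \<Sum>n. a n * x ^ n)"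
proof (rule satisfies_hypergeometric)
  fix n
  have h: "u n * r n * N n = a (Suc n) * (u n * (of_nat n + 1)^3 * D n)"
    using a[of "Suc n"] by (simp only: N_Suc D_Suc)
  have "(of_nat n + 1)^3 * a (Suc n) = r n * a n"
    by (rule quotient_step[OF a h u D])
  then have "2 * (of_nat n + 1)^3 * a (Suc n) = 2 * r n * a n" by (simp only: mult.assoc)
  then show "2 * (of_nat n + 1)^3 * a (Suc n)
      = (2 * of_nat n + 1) * (of_int \<kappa> * of_nat n * (of_nat n + 1) + of_int q) * a n"
    by (simp only: r)
qed fact

lemma satisfies_F1: "satisfies (quadP (-1728) 0) (quadQ 240 0) F1"
  unfolding F1_def[abs_def]
proof (rule satisfies_factorial_quotient)
  let ?u = "\<lambda>n. (3 * of_nat n + 3) * (3 * of_nat n + 2) * (3 * of_nat n + 1) :: complex"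
  let ?r = "\<lambda>n. 8 * (6 * of_nat n + 5) * (6 * of_nat n + 3) * (6 * of_nat n + 1) :: complex"
  fix n :: nat
  define x A B C where "x = (of_nat n :: complex)"
    and "A = (fact (6*n) :: complex)" and "B = (fact (3*n) :: complex)" and "C = (fact n :: complex)"
  note names = x_def[symmetric] A_def[symmetric] B_def[symmetric] C_def[symmetric]
  show "fact (6*n) = of_nat (((6*n) choose (3*n)) * ((3*n) choose (2*n)) * ((2*n) choose n)) * (fact (3*n) * fact n ^ 3 :: complex)"
    by (simp add: binomial_fact divide_simps power_mult_distrib) (simp add: eval_nat_numeral)?
  show "fact (3*n) * fact n ^ 3 \<noteq> (0 :: complex)" by simp
  show "?u n \<noteq> 0"
    using of_nat_plus_1_neq_0[of "3*n"] of_nat_plus_1_neq_0[of "3*n+1"] of_nat_plus_1_neq_0[of "3*n+2"]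
    by (simp add: add_ac)
  show "fact (6*Suc n) = ?u n * ?r n * (fact (6*n))"
    unfolding fact_mult_Suc names by algebra
  show "fact (3*Suc n) * fact (Suc n) ^ 3 = ?u n * (of_nat n + 1)^3 * (fact (3*n) * fact n ^ 3)"
    unfolding fact_mult_Suc names by algebra
  show "2 * ?r n = (2 * of_nat n + 1) * (of_int 1728 * of_nat n * (of_nat n + 1) + of_int 240)"
    unfolding of_int_numeral names by algebra
qed simp

lemma satisfies_F2: "satisfies (quadP (-256) 0) (quadQ 48 0) F2"
  unfolding F2_def[abs_def]
proof (rule satisfies_factorial_quotient)
  let ?u = "\<lambda>n. of_nat n + 1 :: complex"
  let ?r = "\<lambda>n. 8 * (4 * of_nat n + 3) * (2 * of_nat n + 1) * (4 * of_nat n + 1) :: complex"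
  fix n :: nat
  define x A B where "x = (of_nat n :: complex)"
    and "A = (fact (4*n) :: complex)" and "B = (fact n :: complex)"
  note names = x_def[symmetric] A_def[symmetric] B_def[symmetric]
  show "fact (4*n) = of_nat (((4*n) choose (2*n)) * ((2*n) choose n)^2) * (fact n ^ 4 :: complex)"
    by (simp add: binomial_fact divide_simps power_mult_distrib) (simp add: eval_nat_numeral)?
  show "fact n ^ 4 \<noteq> (0 :: complex)" by simp
  show "?u n \<noteq> 0"
    by (simp add: of_nat_plus_1_neq_0)
  show "fact (4*Suc n) = ?u n * ?r n * (fact (4*n))"
    unfolding fact_mult_Suc names by algebra
  show "fact (Suc n) ^ 4 = ?u n * (of_nat n + 1)^3 * (fact n ^ 4)"
    unfolding fact_mult_Suc names by algebra
  show "2 * ?r n = (2 * of_nat n + 1) * (of_int 256 * of_nat n * (of_nat n + 1) + of_int 48)"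
    unfolding of_int_numeral names by algebra
qed simp

lemma satisfies_F3: "satisfies (quadP (-108) 0) (quadQ 24 0) F3"
  unfolding F3_def[abs_def]
proof (rule satisfies_factorial_quotient)
  let ?u = "\<lambda>n. (of_nat n + 1)^2 :: complex"
  let ?r = "\<lambda>n. 6 * (3 * of_nat n + 2) * (3 * of_nat n + 1) * (2 * of_nat n + 1) :: complex"
  fix n :: nat
  define x A B C where "x = (of_nat n :: complex)"
    and "A = (fact (3*n) :: complex)" and "B = (fact (2*n) :: complex)" and "C = (fact n :: complex)"
  note names = x_def[symmetric] A_def[symmetric] B_def[symmetric] C_def[symmetric]
  show "fact (3*n) * fact (2*n) = of_nat (((3*n) choose n) * ((2*n) choose n)^2) * (fact n ^ 5 :: complex)"
    by (simp add: binomial_fact divide_simps power_mult_distrib) (simp add: eval_nat_numeral)?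
  show "fact n ^ 5 \<noteq> (0 :: complex)" by simp
  show "?u n \<noteq> 0"
    by (simp add: of_nat_plus_1_neq_0)
  show "fact (3*Suc n) * fact (2*Suc n) = ?u n * ?r n * (fact (3*n) * fact (2*n))"
    unfolding fact_mult_Suc names by algebra
  show "fact (Suc n) ^ 5 = ?u n * (of_nat n + 1)^3 * (fact n ^ 5)"
    unfolding fact_mult_Suc names by algebra
  show "2 * ?r n = (2 * of_nat n + 1) * (of_int 108 * of_nat n * (of_nat n + 1) + of_int 24)"
    unfolding of_int_numeral names by algebra
qed simp

lemma satisfies_F4: "satisfies (quadP (-64) 0) (quadQ 16 0) F4"
  unfolding F4_def[abs_def]
proof (rule satisfies_factorial_quotient)
  let ?u = "\<lambda>n. (of_nat n + 1)^3 :: complex"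
  let ?r = "\<lambda>n. 8 * (2 * of_nat n + 1)^3 :: complex"
  fix n :: nat
  define x A B where "x = (of_nat n :: complex)"
    and "A = (fact (2*n) :: complex)" and "B = (fact n :: complex)"
  note names = x_def[symmetric] A_def[symmetric] B_def[symmetric]
  show "fact (2*n) ^ 3 = of_nat (((2*n) choose n)^3) * (fact n ^ 6 :: complex)"
    by (simp add: binomial_fact divide_simps power_mult_distrib) (simp add: eval_nat_numeral)?
  show "fact n ^ 6 \<noteq> (0 :: complex)" by simp
  show "?u n \<noteq> 0"
    by (simp add: of_nat_plus_1_neq_0)
  show "fact (2*Suc n) ^ 3 = ?u n * ?r n * (fact (2*n) ^ 3)"
    unfolding fact_mult_Suc names by algebra
  show "fact (Suc n) ^ 6 = ?u n * (of_nat n + 1)^3 * (fact n ^ 6)"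
    unfolding fact_mult_Suc names by algebra
  show "2 * ?r n = (2 * of_nat n + 1) * (of_int 64 * of_nat n * (of_nat n + 1) + of_int 16)"
    unfolding of_int_numeral names by algebra
qed simp

lemma satisfies_G_ser:
  "satisfies (quadP (2*\<alpha>) (\<alpha>^2 + 4*\<gamma>)) (quadQ (4*\<beta> - 2*\<alpha>) (- (\<alpha>^2 + 4*\<gamma>)))
     (G_ser (of_int \<alpha>) (of_int \<beta>) (of_int \<gamma>))"
  unfolding G_ser_def
proof (rule satisfies_of_recurrence)
  fix n
  have nz: "(of_nat n + 1 :: complex) ^ 3 \<noteq> 0" by (simp add: of_nat_plus_1_neq_0)
  let ?T = "T_seq (of_int \<alpha>) (of_int \<beta>) (of_int \<gamma>)"
  have "2 * (of_nat n + 1)^3 * ?T (Suc n) = 2 * (- (2 * of_nat n + 1) * (of_int \<alpha> * of_nat n ^ 2 + of_int \<alpha> * of_nat n + of_int \<alpha> - 2 * of_int \<beta>) * ?T n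
       - (of_int \<alpha> ^ 2 + 4 * of_int \<gamma>) * of_nat n ^ 3 * ?T (n - 1))"
    using nz by simp
  also have "\<dots> = - (2 * of_nat n + 1) * (of_int (2*\<alpha>) * of_nat n * (of_nat n + 1) - of_int (4*\<beta> - 2*\<alpha>)) * ?T n
          - 2 * of_nat n * (of_int (\<alpha>^2 + 4*\<gamma>) * (of_nat n^2 - 1) - of_int (- (\<alpha>^2 + 4*\<gamma>))) * ?T (n - 1)"
    by (simp add: algebra_simps power2_eq_square power3_eq_cube del: T_seq.simps)
  finally show "2 * (of_nat n + 1)^3 * ?T (Suc n) = - (2 * of_nat n + 1) * (of_int (2*\<alpha>) * of_nat n * (of_nat n + 1) - of_int (4*\<beta> - 2*\<alpha>)) * ?T n
          - 2 * of_nat n * (of_int (\<alpha>^2 + 4*\<gamma>) * (of_nat n^2 - 1) - of_int (- (\<alpha>^2 + 4*\<gamma>))) * ?T (n - 1)" .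
qed simp

text \<open>
  The central binomial coefficient turns the recurrence for \<open>t\<close> into one with leading factor \<open>(n + 1)\<^sup>3\<close>. The
  rule lowering its index fails at \<open>n = 0\<close>, where truncated subtraction yields \<open>c 0\<close>; multiplied by \<open>n\<close> it
  holds for all \<open>n\<close>, and the recurrence supplies that factor.
\<close>
lemma satisfies_F_ser:
  "satisfies (quadP (-4*\<alpha>) (-16*\<gamma>)) (quadQ (4*\<beta>) (12*\<gamma>))
     (F_ser (of_int \<alpha>) (of_int \<beta>) (of_int \<gamma>))"
  unfolding F_ser_def
proof (rule satisfies_of_recurrence)
  fix n
  let ?t = "t_seq (of_int \<alpha>) (of_int \<beta>) (of_int \<gamma>)"
  define c :: "nat \<Rightarrow> complex" where "c n = of_nat ((2*n) choose n)" for n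
  define x where "x = (of_nat n :: complex)"
  have c_Suc: "(of_nat n + 1) * c (Suc n) = 2 * (2 * of_nat n + 1) * c n" for n
  proof -
    have c: "fact (2*n) = c n * fact n ^ 2" for n
      by (simp add: c_def binomial_fact power2_eq_square)
    have h: "(of_nat n + 1) * (2 * (2 * of_nat n + 1)) * fact (2*n)
        = c (Suc n) * ((of_nat n + 1) * (of_nat n + 1) * fact n ^ 2)"
      using c[of "Suc n"] unfolding fact_mult_Suc by (simp add: algebra_simps power2_eq_square)
    show ?thesis by (rule quotient_step[OF c h of_nat_plus_1_neq_0]) simp
  qed
  have c_pred: "of_nat n * (of_nat n * c n) = of_nat n * (2 * (2 * of_nat n - 1) * c (n - 1))"
  proof (cases n)
    case (Suc m)
    then show ?thesis using c_Suc[of m] by (simp add: algebra_simps)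
  qed simp
  have t_Suc: "(x + 1)^2 * ?t (Suc n) = (of_int \<alpha> * x^2 + of_int \<alpha> * x + of_int \<beta>) * ?t n + of_int \<gamma> * x^2 * ?t (n - 1)"
    using of_nat_plus_1_neq_0[of n] by (simp add: x_def)
  have "2 * ((x + 1) * c (Suc n)) * ((x + 1)^2 * ?t (Suc n))
     = 2 * (2 * (2 * x + 1) * c n) * (of_int \<alpha> * x^2 + of_int \<alpha> * x + of_int \<beta>) * ?t n
       + 4 * (2 * x + 1) * of_int \<gamma> * (x * (x * c n)) * ?t (n - 1)"
    unfolding t_Suc c_Suc[of n, folded x_def] by (simp add: algebra_simps power2_eq_square del: t_seq.simps)
  also have "x * (x * c n) = x * (2 * (2 * x - 1) * c (n - 1))" using c_pred by (simp only: x_def)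
  finally have "2 * (x + 1)^3 * (c (Suc n) * ?t (Suc n))
      = - (2 * x + 1) * (of_int (-4*\<alpha>) * x * (x + 1) - of_int (4*\<beta>)) * (c n * ?t n)
          - 2 * x * (of_int (-16*\<gamma>) * (x^2 - 1) - of_int (12*\<gamma>)) * (c (n - 1) * ?t (n - 1))"
    by (simp add: algebra_simps power2_eq_square power3_eq_cube del: t_seq.simps)
  then show "2 * (of_nat n + 1)^3 * (of_nat ((2 * Suc n) choose Suc n) * ?t (Suc n))
      = - (2 * of_nat n + 1) * (of_int (-4*\<alpha>) * of_nat n * (of_nat n + 1) - of_int (4*\<beta>)) * (of_nat ((2*n) choose n) * ?t n)
          - 2 * of_nat n * (of_int (-16*\<gamma>) * (of_nat n^2 - 1) - of_int (12*\<gamma>)) * (of_nat ((2*(n - 1)) choose (n - 1)) * ?t (n - 1))"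
    unfolding x_def c_def .
qed simp

lemma satisfies_F6a: "satisfies (quadP 68 1152) (quadQ (-24) (-864)) F6a"
  using satisfies_F_ser[where \<alpha> = "-17" and \<beta> = "-6" and \<gamma> = "-72"] by (simp add: F6a_def)

lemma satisfies_G6a: "satisfies (quadP (-34) 1) (quadQ 10 (-1)) G6a"
  using satisfies_G_ser[where \<alpha> = "-17" and \<beta> = "-6" and \<gamma> = "-72"] by (simp add: G6a_def)

lemma satisfies_F6b: "satisfies (quadP (-40) 144) (quadQ 12 (-108)) F6b"
  using satisfies_F_ser[where \<alpha> = "10" and \<beta> = "3" and \<gamma> = "-9"] by (simp add: F6b_def)

lemma satisfies_G6b: "satisfies (quadP 20 64) (quadQ (-8) (-64)) G6b"
  using satisfies_G_ser[where \<alpha> = "10" and \<beta> = "3" and \<gamma> = "-9"] by (simp add: G6b_def)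

lemma satisfies_F6c: "satisfies (quadP (-28) (-128)) (quadQ 8 96) F6c"
  using satisfies_F_ser[where \<alpha> = "7" and \<beta> = "2" and \<gamma> = "8"] by (simp add: F6c_def)

lemma satisfies_G6c: "satisfies (quadP 14 81) (quadQ (-6) (-81)) G6c"
  using satisfies_G_ser[where \<alpha> = "7" and \<beta> = "2" and \<gamma> = "8"] by (simp add: G6c_def)

section \<open>Polynomials with integer coefficients\<close>

text \<open>
  Everything in the theorem apart from the series and the square roots is a polynomial with integer
  coefficients, so the identities that remain can be checked by integer arithmetic.
\<close>
definition fps_of_int_poly :: "int poly \<Rightarrow> complex fps" where
  "fps_of_int_poly P = fps_of_poly (map_poly of_int P)"

definition represents :: "(complex \<Rightarrow> complex) \<Rightarrow> int poly \<Rightarrow> bool" where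
  "represents f P \<longleftrightarrow> f has_fps_expansion fps_of_int_poly P"

definition theta_poly :: "int poly \<Rightarrow> int poly" where
  "theta_poly P = pCons 0 (pderiv P)"

lemma fps_of_int_poly_nth: "fps_nth (fps_of_int_poly P) n = of_int (coeff P n)"
  by (simp add: fps_of_int_poly_def coeff_map_poly)

lemma fps_of_int_poly_0: "fps_of_int_poly 0 = 0"
  and fps_of_int_poly_add: "fps_of_int_poly (P + Q) = fps_of_int_poly P + fps_of_int_poly Q"
  and fps_of_int_poly_diff: "fps_of_int_poly (P - Q) = fps_of_int_poly P - fps_of_int_poly Q"
  and fps_of_int_poly_uminus: "fps_of_int_poly (- P) = - fps_of_int_poly P"
  and fps_of_int_poly_smult: "fps_of_int_poly (smult c P) = of_int c * fps_of_int_poly P"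
  by (simp_all add: fps_eq_iff fps_of_int_poly_nth of_int_mult_nth)

lemma fps_of_int_poly_mult: "fps_of_int_poly (P * Q) = fps_of_int_poly P * fps_of_int_poly Q"
  by (simp add: fps_eq_iff fps_of_int_poly_nth fps_mult_nth coeff_mult atMost_atLeast0)

lemma fps_of_int_poly_power: "fps_of_int_poly (P ^ n) = fps_of_int_poly P ^ n"
proof (induction n)
  case 0
  then show ?case by (simp add: fps_eq_iff fps_of_int_poly_nth coeff_1)
qed (simp add: fps_of_int_poly_mult)

lemma theta_fps_of_int_poly: "theta (fps_of_int_poly P) = fps_of_int_poly (theta_poly P)"
proof (rule fps_ext)
  show "fps_nth (theta (fps_of_int_poly P)) n = fps_nth (fps_of_int_poly (theta_poly P)) n" for n
    by (cases n) (simp_all add: fps_of_int_poly_nth theta_poly_def coeff_pderiv)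
qed

lemmas fps_of_int_poly_simps = fps_of_int_poly_0 fps_of_int_poly_add fps_of_int_poly_diff
  fps_of_int_poly_uminus fps_of_int_poly_smult fps_of_int_poly_mult fps_of_int_poly_power

lemma represents_numeral: "represents (\<lambda>p. numeral c) [:numeral c:]"
  and represents_1: "represents (\<lambda>p. 1) [:1:]"
  and represents_variable: "represents (\<lambda>p. p) [:0, 1:]"
proof -
  have "fps_of_int_poly [:numeral c:] = numeral c" "fps_of_int_poly [:1:] = 1" "fps_of_int_poly [:0, 1:] = fps_X"
    by (auto simp: fps_eq_iff fps_of_int_poly_nth coeff_pCons fps_numeral_nth fps_X_nth split: nat.splits)
  then show "represents (\<lambda>p. numeral c) [:numeral c:]" "represents (\<lambda>p. 1) [:1:]"
    "represents (\<lambda>p. p) [:0, 1:]"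
    by (simp_all add: represents_def has_fps_expansion_fps_X)
qed

lemma represents_add: "represents f P \<Longrightarrow> represents g Q \<Longrightarrow> represents (\<lambda>p. f p + g p) (P + Q)"
  and represents_diff: "represents f P \<Longrightarrow> represents g Q \<Longrightarrow> represents (\<lambda>p. f p - g p) (P - Q)"
  and represents_uminus: "represents f P \<Longrightarrow> represents (\<lambda>p. - f p) (- P)"
  and represents_mult: "represents f P \<Longrightarrow> represents g Q \<Longrightarrow> represents (\<lambda>p. f p * g p) (P * Q)"
  and represents_power: "represents f P \<Longrightarrow> represents (\<lambda>p. f p ^ n) (P ^ n)"
  unfolding represents_def fps_of_int_poly_simps by (auto intro: fps_expansion_intros)

section \<open>Pullbacks of analytic solutions\<close>

text \<open>
  The prefactors of the theorem are reciprocals of functions \<open>f\<close> of this kind; the property records the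
  polynomial \<open>f\<^sup>2\<close>, which exists even where \<open>f\<close> involves square roots.
\<close>
definition square_represents :: "(complex \<Rightarrow> complex) \<Rightarrow> int poly \<Rightarrow> bool" where
  "square_represents f B \<longleftrightarrow> (\<exists>M. f has_fps_expansion M \<and> f 0 = 1 \<and> M * M = fps_of_int_poly B)"

lemma square_represents_poly:
  assumes "represents f P" "f 0 = 1"
  shows "square_represents f (P ^ 2)"
  using assms unfolding square_represents_def represents_def
  by (auto simp: fps_of_int_poly_mult power2_eq_square)

lemma square_represents_mult:
  assumes "square_represents f B" "square_represents g C"
  shows "square_represents (\<lambda>p. f p * g p) (B * C)"
proof -
  from assms obtain M N where M: "f has_fps_expansion M" "f 0 = 1" "M * M = fps_of_int_poly B"
    and N: "g has_fps_expansion N" "g 0 = 1" "N * N = fps_of_int_poly C"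
    unfolding square_represents_def by blast
  have "(M * N) * (M * N) = fps_of_int_poly (B * C)"
    by (simp add: fps_of_int_poly_mult ac_simps flip: M(3) N(3))
  with has_fps_expansion_mult[OF M(1) N(1)] M(2) N(2) show ?thesis
    unfolding square_represents_def by (intro exI[of _ "M * N"]) simp
qed

lemma square_represents_powr_half:
  assumes F: "represents f P" and f0: "f 0 = 1"
  shows "square_represents (\<lambda>p. f p powr (1/2)) P"
proof -
  have f: "f has_fps_expansion fps_of_int_poly P" using F by (simp add: represents_def)
  then have "f analytic_on {0}" by (rule has_fps_expansion_imp_analytic_0)
  then have "(\<lambda>p. f p powr (1/2)) analytic_on {0}"
    by (intro analytic_intros) (auto simp: f0)
  then obtain M where M: "(\<lambda>p. f p powr (1/2)) has_fps_expansion M"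
    using analytic_at_imp_has_fps_expansion_0 by blast
  have "f p powr (1/2) * f p powr (1/2) = f p" for p
    by (cases "f p = 0") (simp_all flip: powr_add)
  then have "f has_fps_expansion M * M"
    using has_fps_expansion_mult[OF M M] by simp
  then have "M * M = fps_of_int_poly P" using f by (rule fps_expansion_unique_complex)
  with M f0 show ?thesis unfolding square_represents_def by auto
qed

lemma square_represents_powr_three_halves:
  assumes F: "represents f P" and f0: "f 0 = 1"
  shows "square_represents (\<lambda>p. f p powr (3/2)) (P ^ 3)"
proof -
  from square_represents_powr_half[OF F f0] obtain M
    where M: "(\<lambda>p. f p powr (1/2)) has_fps_expansion M" "M * M = fps_of_int_poly P"
    unfolding square_represents_def by blast
  have "f p powr (3/2) = f p * f p powr (1/2)" for p
    using powr_add[of "f p" 1 "1/2"] by (cases "f p = 0") simp_all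
  then have "(\<lambda>p. f p powr (3/2)) has_fps_expansion fps_of_int_poly P * M"
    using has_fps_expansion_mult[OF F[unfolded represents_def] M(1)] by simp
  moreover have "fps_of_int_poly P * M * (fps_of_int_poly P * M) = fps_of_int_poly (P ^ 3)"
    unfolding fps_of_int_poly_power M(2)[symmetric] by (simp add: power3_eq_cube ac_simps)
  ultimately show ?thesis unfolding square_represents_def using f0 by auto
qed

text \<open>
  This is the polynomial \<open>V = (1 - p) (1 - 4 p) (1 - 2 p) (1 + 2 p)\<close>. Its zeros, together with \<open>0\<close> and infinity, are
  the six cusps of the modular curve with coordinate \<open>p\<close>, and \<open>q dp/dq = z p V\<close>, where \<open>z\<close> is the common value of
  the functions and \<open>q\<close> the modular parameter.
\<close>
definition cusp_poly :: "int poly" where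
  "cusp_poly = [:1, -5, 0, 20, -16:]"

text \<open>
  This is the potential \<open>W\<close> which the formula of \<open>ode_pullback\<close> yields for \<open>1 / (1 - 4 p)\<^sup>2\<close> times \<open>G6b\<close>, or for any other
  of the functions: that the result is always the same is what makes the theorem true.
\<close>
definition potential :: "int poly" where
  "potential = [:0, 8, -40, -192, 1376, -1408, -3840, 8192, -4096:]"

definition common_solution :: "(complex \<Rightarrow> complex) \<Rightarrow> bool" where
  "common_solution = satisfies (fps_of_int_poly cusp_poly ^ 2) (fps_of_int_poly potential)"

lemma common_solution_unique:
  assumes "common_solution f" "common_solution g"
  shows "eventually (\<lambda>p. f p = g p) (nhds 0)"
  using assms unfolding common_solution_def
  by (rule satisfies_unique) (simp_all add: power2_eq_square fps_mult_nth_0 fps_of_int_poly_nth cusp_poly_def potential_def)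

text \<open>
  The numerators of all arguments are products of factors vanishing only at cusps. For those \<open>K / V\<close> is the
  logarithmic derivative, which can be read off from the factors.
\<close>
definition log_deriv :: "int poly \<Rightarrow> int poly \<Rightarrow> bool" where
  "log_deriv F K \<longleftrightarrow> cusp_poly * theta_poly F = K * F"

lemma theta_poly_mult: "theta_poly (F * G) = theta_poly F * G + F * theta_poly G"
  by (simp add: theta_poly_def pderiv_mult algebra_simps)

lemma log_deriv_mult:
  assumes "log_deriv F K" "log_deriv G L"
  shows "log_deriv (F * G) (K + L)"
proof -
  have "cusp_poly * theta_poly (F * G) = (cusp_poly * theta_poly F) * G + F * (cusp_poly * theta_poly G)"
    by (simp add: theta_poly_mult algebra_simps)
  then show ?thesis using assms by (simp add: log_deriv_def algebra_simps)
qed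

lemma log_deriv_power_numeral:
  assumes "log_deriv F K"
  shows "log_deriv (F ^ numeral n) (smult (numeral n) K)"
proof -
  have "log_deriv (F ^ m) (smult (int m) K)" for m
  proof (induction m)
    case 0
    then show ?case by (simp add: log_deriv_def theta_poly_def)
  next
    case (Suc m)
    from log_deriv_mult[OF assms Suc] show ?case by (simp add: smult_add_left)
  qed
  from this[of "numeral n"] show ?thesis by simp
qed

lemma log_deriv_uminus: "log_deriv F K \<Longrightarrow> log_deriv (- F) K"
  using log_deriv_mult[of "-1" 0 F K] by (simp add: log_deriv_def theta_poly_def pderiv_minus)

text \<open>
  The factors appear unexpanded, in the form in which the rules for \<open>represents\<close> produce them.
\<close>
lemma log_deriv_factors:
  "log_deriv [:0, 1:] [:1, -5, 0, 20, -16:]"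
  "log_deriv ([:1:] - [:0, 1:]) [:0, -1, 4, 4, -16:]"
  "log_deriv ([:1:] - [:4:] * [:0, 1:]) [:0, -4, 4, 16, -16:]"
  "log_deriv ([:1:] - [:2:] * [:0, 1:]) [:0, -2, 6, 12, -16:]"
  "log_deriv ([:1:] + [:2:] * [:0, 1:]) [:0, 2, -14, 28, -16:]"
  "log_deriv ([:1:] - [:4:] * [:0, 1:] ^ 2) [:0, 0, -8, 40, -32:]"
  by (simp_all add: log_deriv_def theta_poly_def cusp_poly_def pderiv_pCons power2_eq_square)

text \<open>
  The hypotheses of \<open>ode_pullback\<close> for \<open>x = N / D\<close>, multiplied by \<open>B\<^sup>3\<close> so that they become identities between
  polynomials. The denominator \<open>D\<close> is \<open>M\<^sup>j\<close>, expressed through \<open>B = M\<^sup>2\<close> because \<open>M\<close> itself need not be a polynomial;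
  \<open>E\<close> and \<open>E2\<close> are the cofactors \<open>B\<^sup>3 / D\<close> and \<open>B\<^sup>3 / D\<^sup>2\<close>, so that \<open>y1\<close> and \<open>y2\<close> are \<open>x B\<^sup>3\<close> and \<open>x\<^sup>2 B\<^sup>3\<close>. The second
  cofactor exists only for \<open>j \<le> 3\<close>; if \<open>P\<close> and \<open>Q\<close> are linear, so that \<open>x\<^sup>2\<close> does not occur, \<open>E2\<close> is \<open>0\<close>. The names
  \<open>b, m, m', y1, y2\<close> stand for expanded polynomials, so that each of them is computed only once.
\<close>
lemma satisfies_pullback:
  fixes p1 p2 q1 q2 k :: int
  assumes G: "satisfies (quadP p1 p2) (quadQ q1 q2) G"
    and M: "square_represents M B" and N: "represents n N" and D: "represents d D"
    and n0: "n 0 = 0" and d0: "d 0 = 1" and K: "log_deriv N K"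
    and DB: "D^2 = B^j" and DE: "D * E = B^3"
    and E2: "p2 = 0 \<and> q2 = 0 \<and> E2 = 0 \<or> D * E2 = E"
    and b: "B = b" and y1: "N * E = y1" and y2: "N^2 * E2 = y2"
    and m: "cusp_poly * theta_poly b = m" and m': "cusp_poly * theta_poly m = m'"
    and e: "smult 2 (K * b) - smult (int j) m = smult (2 * k) e"
    and disc: "b^3 + smult p1 y1 + smult p2 y2 = e^2"
    and pot: "smult (4 * k * k) (smult q1 y1 + smult q2 y2) + smult 5 (m^2)
        = smult 4 (b * (potential * b + m'))"
  shows "common_solution (\<lambda>p. 1 / M p * G (n p / d p))"
proof -
  let ?F = fps_of_int_poly
  let ?V = "?F cusp_poly" and ?W = "?F potential"
  from G obtain Y where Y: "G has_fps_expansion Y" "fps_nth Y 0 = 1" "ode (quadP p1 p2) (quadQ q1 q2) Y"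
    unfolding satisfies_def by blast
  from M obtain R where R: "M has_fps_expansion R" "R * R = ?F B" and M0: "M 0 = 1"
    unfolding square_represents_def by blast
  note N = N[unfolded represents_def] and D = D[unfolded represents_def]
  have R0: "fps_nth R 0 = 1" using has_fps_expansion_imp_0_eq_fps_nth_0[OF R(1)] M0 by simp
  have N0: "fps_nth (?F N) 0 = 0" using has_fps_expansion_imp_0_eq_fps_nth_0[OF N] n0 by simp
  have D0: "fps_nth (?F D) 0 = 1" using has_fps_expansion_imp_0_eq_fps_nth_0[OF D] d0 by simp
  have B0: "fps_nth (?F B) 0 = 1" using R0 by (simp add: fps_mult_nth_0 flip: R(2))
  have V0: "fps_nth ?V 0 = 1" by (simp add: fps_of_int_poly_nth cusp_poly_def)
  have nz: "?V \<noteq> 0" "?F B \<noteq> 0" "?F D \<noteq> 0"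
    using V0 B0 D0 by (metis fps_zero_nth zero_neq_one)+
  define x where "x = ?F N * inverse (?F D)"
  have x0: "fps_nth x 0 = 0" by (simp add: x_def fps_mult_nth_0 N0)
  have xD: "x * ?F D = ?F N" using D0 by (simp add: x_def mult.assoc inverse_mult_eq_1)
  define f where "f = inverse R * (Y oo x)"
  have fR: "f * R = Y oo x"
    using R0 by (simp add: f_def mult_ac inverse_mult_eq_1')
  have DE': "?F D * ?F E = ?F B ^ 3"
    using arg_cong[OF DE, of ?F] by (simp add: fps_of_int_poly_simps)
  have y1': "x * ?F B ^ 3 = ?F y1"
    by (simp add: fps_of_int_poly_simps flip: y1 DE' xD mult.assoc)
  have y2': "of_int p2 * (x^2 * ?F B ^ 3) = of_int p2 * ?F y2"
    and y2'': "of_int q2 * (x^2 * ?F B ^ 3) = of_int q2 * ?F y2"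
  proof -
    consider "p2 = 0" "q2 = 0" | "D * E2 = E" using E2 by blast
    then have "of_int p2 * (x^2 * ?F B ^ 3) = of_int p2 * ?F y2
      \<and> of_int q2 * (x^2 * ?F B ^ 3) = of_int q2 * ?F y2"
    proof cases
      case 2
      have "x^2 * ?F B ^ 3 = (x * ?F D)^2 * ?F E2"
        unfolding DE'[symmetric] 2[symmetric] fps_of_int_poly_mult by (simp add: power2_eq_square ac_simps)
      also have "\<dots> = ?F y2" unfolding xD by (simp add: fps_of_int_poly_simps flip: y2)
      finally show ?thesis by simp
    qed simp
    then show "of_int p2 * (x^2 * ?F B ^ 3) = of_int p2 * ?F y2"
      "of_int q2 * (x^2 * ?F B ^ 3) = of_int q2 * ?F y2" by blast+
  qed
  have comp_int: "(of_int c * F oo x) = of_int c * (F oo x)" for c F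
    using x0 by (simp add: fps_compose_mult_distrib flip: fps_of_int)
  have comp: "quadP p1 p2 oo x = 1 + of_int p1 * x + of_int p2 * x^2"
    "quadQ q1 q2 oo x = of_int q1 * x + of_int q2 * x^2"
    using x0 by (simp_all add: fps_compose_add_distrib comp_int power2_eq_square fps_compose_mult_distrib)
  have P: "(quadP p1 p2 oo x) * ?F B ^ 3 = ?F e ^ 2"
  proof -
    have "(quadP p1 p2 oo x) * ?F B ^ 3 = ?F B ^ 3 + of_int p1 * (x * ?F B ^ 3) + of_int p2 * (x^2 * ?F B ^ 3)"
      unfolding comp by (simp add: algebra_simps)
    also have "\<dots> = ?F (b^3 + smult p1 y1 + smult p2 y2)"
      unfolding y1' y2' by (simp add: fps_of_int_poly_simps b)
    finally show ?thesis by (simp add: disc fps_of_int_poly_power)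
  qed
  have Q: "(quadQ q1 q2 oo x) * ?F B ^ 3 = ?F (smult q1 y1 + smult q2 y2)"
  proof -
    have "(quadQ q1 q2 oo x) * ?F B ^ 3 = of_int q1 * (x * ?F B ^ 3) + of_int q2 * (x^2 * ?F B ^ 3)"
      unfolding comp by (simp add: algebra_simps)
    then show ?thesis unfolding y1' y2'' by (simp add: fps_of_int_poly_simps)
  qed
  have m_fps: "?V * theta (?F B) = ?F m"
    by (simp only: theta_fps_of_int_poly b m[symmetric] fps_of_int_poly_mult)
  have m'_fps: "?V * theta (?F m) = ?F m'"
    by (simp only: theta_fps_of_int_poly m'[symmetric] fps_of_int_poly_mult)
  have dx: "?F B * ?V * theta x = of_int k * ?F e * x"
  proof -
    have "?F D * theta (?F D ^ 2) = 2 * ?F D ^ 2 * theta (?F D)"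
      by (simp add: power2_eq_square algebra_simps)
    moreover have "?F B * theta (?F D ^ 2) = of_nat j * ?F D ^ 2 * theta (?F B)"
      using arg_cong[OF DB, of ?F] theta_power[of "?F B" j] by (simp add: fps_of_int_poly_simps)
    ultimately have "?F D ^ 2 * (2 * ?F B * theta (?F D)) = ?F D ^ 2 * (of_nat j * ?F D * theta (?F B))"
      by (metis (no_types, lifting) mult.assoc mult.commute)
    then have dD: "2 * ?F B * theta (?F D) = of_nat j * ?F D * theta (?F B)"
      using nz by (simp only: mult_cancel_left) simp
    have dN: "?V * theta (x * ?F D) = ?F K * (x * ?F D)"
      using arg_cong[OF K[unfolded log_deriv_def], of ?F] unfolding xD
      by (simp add: theta_fps_of_int_poly fps_of_int_poly_simps)
    have e': "2 * ?F K * ?F B - of_nat j * ?F m = 2 * of_int k * ?F e"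
      using arg_cong[OF e, of ?F] by (simp add: fps_of_int_poly_simps b ac_simps)
    have "2 * ?F D * (?F B * ?V * theta x)
        = 2 * ?F B * (?V * theta (x * ?F D)) - ?V * x * (2 * ?F B * theta (?F D))"
      by (simp add: algebra_simps)
    also have "\<dots> = ?F D * x * (2 * ?F K * ?F B - of_nat j * (?V * theta (?F B)))"
      unfolding dN dD by (simp add: algebra_simps)
    also have "\<dots> = 2 * ?F D * (of_int k * ?F e * x)"
      unfolding m_fps e' by (simp add: ac_simps)
    finally show ?thesis using nz by simp
  qed
  have e_nz: "?F e \<noteq> 0"
  proof
    assume "?F e = 0"
    then have "fps_nth ((quadP p1 p2 oo x) * ?F B ^ 3) 0 = 0" by (simp add: P)
    then show False by (simp add: comp fps_mult_nth_0 B0 x0 power2_eq_square power3_eq_cube)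
  qed
  have "ode (?V^2) ?W f"
  proof (rule ode_pullback[OF Y(3) x0 R(2) fR nz(1,2) e_nz dx P])
    have "4 * of_int k ^ 2 * (quadQ q1 q2 oo x) * ?F B ^ 3
        = ?F (smult (4 * k * k) (smult q1 y1 + smult q2 y2))"
      using Q by (simp add: fps_of_int_poly_smult power2_eq_square mult.assoc)
    also have "\<dots> = ?F (smult 4 (b * (potential * b + m'))) - ?F (smult 5 (m^2))"
      unfolding pot[symmetric] fps_of_int_poly_add by simp
    also have "\<dots> = 4 * ?W * ?F B ^ 2 + 4 * ?F B * ?V * theta (?V * theta (?F B)) - 5 * (?V * theta (?F B))^2"
      unfolding m_fps mult.assoc[of _ ?V] m'_fps by (simp add: fps_of_int_poly_simps b algebra_simps power2_eq_square)
    finally show "4 * of_int k ^ 2 * (quadQ q1 q2 oo x) * ?F B ^ 3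
        = 4 * ?W * ?F B ^ 2 + 4 * ?F B * ?V * theta (?V * theta (?F B)) - 5 * (?V * theta (?F B))^2" .
  qed
  moreover have "fps_nth f 0 = 1"
    by (simp add: f_def fps_mult_nth_0 R0 Y(2))
  moreover have "(\<lambda>p. 1 / M p * G (n p / d p)) has_fps_expansion f"
  proof -
    have "(\<lambda>p. n p * inverse (d p)) has_fps_expansion x"
      unfolding x_def using N D D0 by (intro has_fps_expansion_mult has_fps_expansion_inverse) auto
    then have "(G \<circ> (\<lambda>p. n p * inverse (d p))) has_fps_expansion (Y oo x)"
      using Y(1) x0 by (intro has_fps_expansion_compose)
    moreover have "(\<lambda>p. inverse (M p)) has_fps_expansion inverse R"
      using R(1) R0 by (intro has_fps_expansion_inverse) auto
    ultimately have "(\<lambda>p. inverse (M p) * (G \<circ> (\<lambda>p. n p * inverse (d p))) p) has_fps_expansion f"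
      unfolding f_def by (rule has_fps_expansion_mult[rotated])
    then show ?thesis by (simp add: divide_inverse o_def)
  qed
  ultimately show ?thesis unfolding common_solution_def satisfies_def by blast
qed

text \<open>
  An equation under another name: the right-hand sides below are found by expanding the left-hand sides, and must
  not be instantiated by reflexivity before that.
\<close>
definition evaluates_to :: "int poly \<Rightarrow> int poly \<Rightarrow> bool" where
  "evaluates_to P p \<longleftrightarrow> P = p"

text \<open>
  The exponent \<open>j\<close> of the denominator \<open>M\<^sup>j\<close> is 6, 4, 3, 2 at levels 1, 2, 3, 4, and 2 or 1 at level 6. For even \<open>j\<close> the
  denominator is the power \<open>B\<^sup>i\<close> with \<open>i = j / 2\<close>; for odd \<open>j\<close> only its square is a power of \<open>B\<close>, and the cofactor
  \<open>B\<^sup>3 / D\<close> again involves \<open>D\<close>. At level 6 the polynomials \<open>P\<close> and \<open>Q\<close> have degree two.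
\<close>
lemma pullback_even:
  fixes p1 q1 k :: int
  assumes "satisfies (quadP p1 0) (quadQ q1 0) G"
    "square_represents M B" "represents n N" "represents d D" "n 0 = 0" "d 0 = 1" "log_deriv N K"
    and D: "D = B ^ i" and i: "i + a = 3"
    and "evaluates_to B b" "evaluates_to (N * b ^ a) y1"
      "evaluates_to (cusp_poly * theta_poly b) m" "evaluates_to (cusp_poly * theta_poly m) m'"
      "smult 2 (K * b) - smult (int (2 * i)) m = smult (2 * k) e"
      "b^3 + smult p1 y1 = e^2"
      "smult (4 * k * k) (smult q1 y1) + smult 5 (m^2) = smult 4 (b * (potential * b + m'))"
  shows "common_solution (\<lambda>p. 1 / M p * G (n p / d p))"
  by (rule satisfies_pullback[where ?p1.0 = p1 and ?p2.0 = 0 and ?q1.0 = q1 and ?q2.0 = 0 and E = "B ^ a"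
        and ?E2.0 = 0 and ?y2.0 = 0 and j = "2 * i"])
     (use assms in \<open>auto simp: evaluates_to_def power_mult mult.commute[of 2] simp flip: power_add\<close>)

lemma pullback_cubic:
  fixes p1 q1 k :: int
  assumes "satisfies (quadP p1 0) (quadQ q1 0) G"
    "square_represents M B" "represents n N" "represents d D" "n 0 = 0" "d 0 = 1" "log_deriv N K"
    and D: "D ^ 2 = B ^ 3"
    and "evaluates_to B b" "evaluates_to (N * D) y1"
      "evaluates_to (cusp_poly * theta_poly b) m" "evaluates_to (cusp_poly * theta_poly m) m'"
      "smult 2 (K * b) - smult 3 m = smult (2 * k) e"
      "b^3 + smult p1 y1 = e^2"
      "smult (4 * k * k) (smult q1 y1) + smult 5 (m^2) = smult 4 (b * (potential * b + m'))"
  shows "common_solution (\<lambda>p. 1 / M p * G (n p / d p))"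
  by (rule satisfies_pullback[where ?p1.0 = p1 and ?p2.0 = 0 and ?q1.0 = q1 and ?q2.0 = 0 and E = D
        and ?E2.0 = 0 and ?y2.0 = 0 and j = 3])
     (use assms in \<open>auto simp: evaluates_to_def power2_eq_square\<close>)

lemma pullback_square:
  fixes p1 p2 q1 q2 k :: int
  assumes "satisfies (quadP p1 p2) (quadQ q1 q2) G"
    "square_represents M B" "represents n N" "represents d D" "n 0 = 0" "d 0 = 1" "log_deriv N K"
    and D: "D = B"
    and "evaluates_to B b" "evaluates_to (N * b^2) y1" "evaluates_to (N^2 * b) y2"
      "evaluates_to (cusp_poly * theta_poly b) m" "evaluates_to (cusp_poly * theta_poly m) m'"
      "smult 2 (K * b) - smult 2 m = smult (2 * k) e"
      "b^3 + smult p1 y1 + smult p2 y2 = e^2"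
      "smult (4 * k * k) (smult q1 y1 + smult q2 y2) + smult 5 (m^2) = smult 4 (b * (potential * b + m'))"
  shows "common_solution (\<lambda>p. 1 / M p * G (n p / d p))"
  by (rule satisfies_pullback[where ?p1.0 = p1 and ?p2.0 = p2 and ?q1.0 = q1 and ?q2.0 = q2 and E = "B^2"
        and ?E2.0 = B and j = 2])
     (use assms in \<open>auto simp: evaluates_to_def power2_eq_square power3_eq_cube\<close>)

lemma pullback_linear:
  fixes p1 p2 q1 q2 k :: int
  assumes "satisfies (quadP p1 p2) (quadQ q1 q2) G"
    "square_represents M B" "represents n N" "represents d D" "n 0 = 0" "d 0 = 1" "log_deriv N K"
    and D: "D ^ 2 = B"
    and "evaluates_to B b" "evaluates_to (N * (b^2 * D)) y1" "evaluates_to (N^2 * b^2) y2"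
      "evaluates_to (cusp_poly * theta_poly b) m" "evaluates_to (cusp_poly * theta_poly m) m'"
      "smult 2 (K * b) - smult 1 m = smult (2 * k) e"
      "b^3 + smult p1 y1 + smult p2 y2 = e^2"
      "smult (4 * k * k) (smult q1 y1 + smult q2 y2) + smult 5 (m^2) = smult 4 (b * (potential * b + m'))"
  shows "common_solution (\<lambda>p. 1 / M p * G (n p / d p))"
  by (rule satisfies_pullback[where ?p1.0 = p1 and ?p2.0 = p2 and ?q1.0 = q1 and ?q2.0 = q2 and E = "B^2 * D"
        and ?E2.0 = "B^2" and j = 1])
     (use assms in \<open>auto simp: evaluates_to_def power2_eq_square power3_eq_cube ac_simps\<close>)

section \<open>The common equation of the forty-two functions\<close>

lemma power_numeral_Suc: "(z :: 'a::monoid_mult) ^ numeral n = z * z ^ pred_numeral n"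
  by (simp add: numeral_eq_Suc)

text \<open>
  These rules decompose a function along its syntax. The order matters for square roots, because
  \<open>square_represents_poly\<close> applies to every function.
\<close>
lemmas syntactic_rules = square_represents_powr_half square_represents_powr_three_halves square_represents_mult
  square_represents_poly represents_add represents_diff represents_uminus represents_mult represents_power
  represents_1 represents_numeral represents_variable
  log_deriv_factors log_deriv_mult log_deriv_power_numeral log_deriv_uminus

text \<open>
  Evaluation at \<open>0\<close>, and the laws of exponents, which settle the relation between \<open>D\<close> and \<open>B\<close> while both are
  still products of powers.
\<close>
lemmas side_rules = mult_zero_left mult_zero_right minus_zero diff_zero add_0_left add_0_right
  power_zero_numeral power_one mult_1_left power_mult_distrib power_mult[symmetric] power_one_right arith_simps

text \<open>
  Arithmetic of polynomials given by lists of integer coefficients. A power is unfolded one factor at a time, so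
  that powers of linear polynomials are expanded by multiplications with a linear factor.
\<close>
lemmas poly_arith = pCons_0_0 mult_pCons_left smult_pCons smult_0_left smult_0_right
  add_pCons diff_pCons minus_pCons pderiv_pCons pderiv_0 pCons_eq_iff
  power_numeral_Suc pred_numeral_simps Num.BitM.simps Num.inc.simps power_0 power_one_right numeral_One
  add_0_left add_0_right diff_0 diff_0_right minus_zero minus_minus
  mult_zero_left mult_zero_right mult_1_left mult_1_right mult_minus1 mult_minus1_right
  arith_simps arith_special rel_simps simp_thms of_nat_numeral of_nat_mult of_nat_1
  evaluates_to_def theta_poly_def cusp_poly_def potential_def

text \<open>
  In each case two data are supplied: the order \<open>k\<close> of vanishing of the argument \<open>x\<close> at \<open>p = 0\<close>, which is the
  exponent for which \<open>x\<close> is a modular function of \<open>q\<^sup>k\<close> or \<open>- q\<^sup>k\<close>, and the polynomial \<open>e\<close> with \<open>P(x) B\<^sup>3 = e\<^sup>2\<close> and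
  constant term \<open>1\<close>. At this level the relation is \<open>E\<^sub>4\<^sup>3 - 1728 \<Delta> = E\<^sub>6\<^sup>2\<close>, with \<open>B\<close> in the role of \<open>E\<^sub>4\<close> and \<open>e\<close> in the
  role of \<open>E\<^sub>6\<close>.
\<close>
lemma level1_common_solution:
  "\<forall>f\<in>set level1_functions. common_solution f"
  unfolding level1_functions_def list.set ball_simps
proof (intro conjI TrueI, goal_cases)
  case 1
  show ?case
    by (rule pullback_even[OF satisfies_F1, where i = 3 and a = 0 and k = 1 and e =
        "[:1, -516, -11040, 23648, 68832, -43776, -597504, 1179648, -737280, -163840, 786432, -786432,
        262144:]"],
      (rule syntactic_rules | (simp only: side_rules; fail))+, (simp only: poly_arith)+)
next
  case 2
  show ?case
    by (rule pullback_even[OF satisfies_F1, where i = 3 and a = 0 and k = 2 and e =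
        "[:1, -12, -456, 5000, -32472, 137664, -355584, 550656, -519552, 320000, -116736, -12288, 4096:]"],
      (rule syntactic_rules | (simp only: side_rules; fail))+, (simp only: poly_arith)+)
next
  case 3
  show ?case
    by (rule pullback_even[OF satisfies_F1, where i = 3 and a = 0 and k = 3 and e =
        "[:1, -12, 48, -544, 4320, -11520, -16896, 147456, -221184, -163840, 786432, -786432, 262144:]"],
      (rule syntactic_rules | (simp only: side_rules; fail))+, (simp only: poly_arith)+)
next
  case 4
  show ?case
    by (rule pullback_even[OF satisfies_F1, where i = 3 and a = 0 and k = 4 and e =
        "[:1, -12, 48, -40, -720, 4608, -9336, -2736, 17208, 23648, -44160, -8256, 64:]"],
      (rule syntactic_rules | (simp only: side_rules; fail))+, (simp only: poly_arith)+)
next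
  case 5
  show ?case
    by (rule pullback_even[OF satisfies_F1, where i = 3 and a = 0 and k = 6 and e =
        "[:1, -12, 48, -40, -216, 576, -768, 2304, -3456, -2560, 12288, -12288, 4096:]"],
      (rule syntactic_rules | (simp only: side_rules; fail))+, (simp only: poly_arith)+)
next
  case 6
  show ?case
    by (rule pullback_even[OF satisfies_F1, where i = 3 and a = 0 and k = 12 and e =
        "[:1, -12, 48, -40, -216, 576, -264, -720, 1080, -544, 192, -192, 64:]"],
      (rule syntactic_rules | (simp only: side_rules; fail))+, (simp only: poly_arith)+)
next
  case 7
  show ?case
    by (rule pullback_even[OF satisfies_F1, where i = 3 and a = 0 and k = 1 and e =
        "[:1, 492, -22128, 308912, -2165904, 8834688, -22273536, 35338752, -34654464, 19770368,
        -5664768, 503808, 4096:]"],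
      (rule syntactic_rules | (simp only: side_rules; fail))+, (simp only: poly_arith)+)
next
  case 8
  show ?case
    by (rule pullback_even[OF satisfies_F1, where i = 3 and a = 0 and k = 3 and e =
        "[:1, -12, 48, 464, -4752, 12672, -16896, 50688, -76032, 29696, 12288, -12288, 4096:]"],
      (rule syntactic_rules | (simp only: side_rules; fail))+, (simp only: poly_arith)+)
qed

lemma level2_common_solution:
  "\<forall>f\<in>set level2_functions. common_solution f"
  unfolding level2_functions_def list.set ball_simps minus_divide_left
proof (intro conjI TrueI, goal_cases)
  case 1
  show ?case
    by (rule pullback_even[OF satisfies_F2, where i = 2 and a = 1 and k = 1 and e =
        "[:1, -68, -1632, 7072, -21216, 117504, -382464, 620544, -543744, 266240, -16384, -98304,
        32768:]"],
      (rule syntactic_rules | (simp only: side_rules; fail))+, (simp only: poly_arith)+)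
next
  case 2
  show ?case
    by (rule pullback_even[OF satisfies_F2, where i = 2 and a = 1 and k = 2 and e =
        "[:1, -12, -8, 520, -4248, 19392, -47808, 58752, -42432, 56576, -52224, -8704, 512:]"],
      (rule syntactic_rules | (simp only: side_rules; fail))+, (simp only: poly_arith)+)
next
  case 3
  show ?case
    by (rule pullback_even[OF satisfies_F2, where i = 2 and a = 1 and k = 3 and e =
        "[:1, -12, 48, -96, 288, -768, -2560, 18432, -27648, -20480, 98304, -98304, 32768:]"],
      (rule syntactic_rules | (simp only: side_rules; fail))+, (simp only: poly_arith)+)
next
  case 4
  show ?case
    by (rule pullback_even[OF satisfies_F2, where i = 2 and a = 1 and k = 6 and e =
        "[:1, -12, 48, -40, -216, 576, -320, -384, 576, -768, 1536, -1536, 512:]"],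
      (rule syntactic_rules | (simp only: side_rules; fail))+, (simp only: poly_arith)+)
next
  case 5
  show ?case
    by (rule pullback_even[OF satisfies_F2, where i = 2 and a = 1 and k = 1 and e =
        "[:1, 44, -2864, 38768, -269520, 1104000, -2790912, 4416000, -4312320, 2481152, -733184, 45056,
        4096:]"],
      (rule syntactic_rules | (simp only: side_rules; fail))+, (simp only: poly_arith)+)
next
  case 6
  show ?case
    by (rule pullback_even[OF satisfies_F2, where i = 2 and a = 1 and k = 3 and e =
        "[:1, -12, 48, 16, -720, 1920, -2560, 7680, -11520, 1024, 12288, -12288, 4096:]"],
      (rule syntactic_rules | (simp only: side_rules; fail))+, (simp only: poly_arith)+)
qed

lemma level3_common_solution:
  "\<forall>f\<in>set level3_functions. common_solution f"
  unfolding level3_functions_def list.set ball_simps minus_divide_left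
proof (intro conjI TrueI, goal_cases)
  case 1
  show ?case
    by (rule pullback_cubic[OF satisfies_F3, where k = 1 and e =
        "[:1, -30, -348, 320, 6624, -12672, -37632, 184320, -239616, -163840, 786432, -786432, 262144:]"],
      (rule syntactic_rules | (simp only: side_rules; fail))+, (simp only: poly_arith)+)
next
  case 2
  show ?case
    by (rule pullback_cubic[OF satisfies_F3, where k = 2 and e =
        "[:1, -12, 30, 140, -1368, 5472, -13440, 21888, -21888, 8960, 7680, -12288, 4096:]"],
      (rule syntactic_rules | (simp only: side_rules; fail))+, (simp only: poly_arith)+)
next
  case 3
  show ?case
    by (rule pullback_cubic[OF satisfies_F3, where k = 4 and e =
        "[:1, -12, 48, -40, -234, 720, -588, -792, 1656, 320, -1392, -480, 64:]"],
      (rule syntactic_rules | (simp only: side_rules; fail))+, (simp only: poly_arith)+)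
next
  case 4
  show ?case
    by (rule pullback_cubic[OF satisfies_F3, where k = 1 and e =
        "[:1, 6, -744, 11480, -81936, 327744, -811776, 1310976, -1310976, 734720, -190464, 6144, 4096:]"],
      (rule syntactic_rules | (simp only: side_rules; fail))+, (simp only: poly_arith)+)
qed

lemma level4_common_solution:
  "\<forall>f\<in>set level4_functions. common_solution f"
  unfolding level4_functions_def list.set ball_simps minus_divide_left
proof (intro conjI TrueI, goal_cases)
  case 1
  show ?case
    by (rule pullback_even[OF satisfies_F4, where i = 1 and a = 2 and k = 1 and e =
        "[:1, -20, -112, 176, 1392, -384, -7680, -1536, 22272, 11264, -28672, -20480, 4096:]"],
      (rule syntactic_rules | (simp only: side_rules; fail))+, (simp only: poly_arith)+)
next
  case 2
  show ?case
    by (rule pullback_even[OF satisfies_F4, where i = 1 and a = 2 and k = 3 and e =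
        "[:1, -12, 48, -48, -144, 384, -512, 1536, -2304, -3072, 12288, -12288, 4096:]"],
      (rule syntactic_rules | (simp only: side_rules; fail))+, (simp only: poly_arith)+)
next
  case 3
  show ?case
    by (rule pullback_even[OF satisfies_F4, where i = 1 and a = 2 and k = 1 and e =
        "[:1, -4, -288, 4704, -34080, 140544, -351744, 540672, -516096, 327680, -131072:]"],
      (rule syntactic_rules | (simp only: side_rules; fail))+, (simp only: poly_arith)+)
next
  case 4
  show ?case
    by (rule pullback_even[OF satisfies_F4, where i = 1 and a = 2 and k = 3 and e =
        "[:1, -12, 48, -32, -288, 768, -512:]"],
      (rule syntactic_rules | (simp only: side_rules; fail))+, (simp only: poly_arith)+)
next
  case 5
  show ?case
    by (rule pullback_even[OF satisfies_F4, where i = 1 and a = 2 and k = 2 and e =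
        "[:1, -12, 56, -120, -216, 2496, -3840, -11520, 25728, 18944, -43008, -8192:]"],
      (rule syntactic_rules | (simp only: side_rules; fail))+, (simp only: poly_arith)+)
next
  case 6
  show ?case
    by (rule pullback_even[OF satisfies_F4, where i = 1 and a = 2 and k = 6 and e =
        "[:1, -12, 48, -40, -216, 576, -256, -768, 1152, -512:]"],
      (rule syntactic_rules | (simp only: side_rules; fail))+, (simp only: poly_arith)+)
qed

lemma level6_F_common_solution:
  "\<forall>f\<in>set level6_F_functions. common_solution f"
  unfolding level6_F_functions_def list.set ball_simps
proof (intro conjI TrueI, goal_cases)
  case 1
  show ?case
    by (rule pullback_square[OF satisfies_F6a, where k = 1 and e =
        "[:1, -14, -12, 160, -480, 3456, -16128, 39936, -46080, -10240, 94208, -98304, 32768:]"],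
      (rule syntactic_rules | (simp only: side_rules; fail))+, (simp only: poly_arith)+)
next
  case 2
  show ?case
    by (rule pullback_square[OF satisfies_F6a, where k = 2 and e =
        "[:1, -12, 46, -20, -360, 1248, -2016, 1728, -960, 1280, -384, -1792, 512:]"],
      (rule syntactic_rules | (simp only: side_rules; fail))+, (simp only: poly_arith)+)
next
  case 3
  show ?case
    by (rule pullback_square[OF satisfies_F6a, where k = 1 and e =
        "[:1, -10, -56, 1400, -10320, 41280, -102144, 165120, -165120, 89600, -14336, -10240, 4096:]"],
      (rule syntactic_rules | (simp only: side_rules; fail))+, (simp only: poly_arith)+)
next
  case 4
  show ?case
    by (rule pullback_square[OF satisfies_F6b, where k = 1 and e =
        "[:1, -14, -12, 160, -480, 3456, -16128, 39936, -46080, -10240, 94208, -98304, 32768:]"],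
      (rule syntactic_rules | (simp only: side_rules; fail))+, (simp only: poly_arith)+)
next
  case 5
  show ?case
    by (rule pullback_square[OF satisfies_F6b, where k = 2 and e =
        "[:1, -12, 46, -20, -360, 1248, -2016, 1728, -960, 1280, -384, -1792, 512:]"],
      (rule syntactic_rules | (simp only: side_rules; fail))+, (simp only: poly_arith)+)
next
  case 6
  show ?case
    by (rule pullback_square[OF satisfies_F6b, where k = 1 and e =
        "[:1, -10, -56, 1400, -10320, 41280, -102144, 165120, -165120, 89600, -14336, -10240, 4096:]"],
      (rule syntactic_rules | (simp only: side_rules; fail))+, (simp only: poly_arith)+)
next
  case 7
  show ?case
    by (rule pullback_square[OF satisfies_F6c, where k = 1 and e =
        "[:1, -14, -12, 160, -480, 3456, -16128, 39936, -46080, -10240, 94208, -98304, 32768:]"],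
      (rule syntactic_rules | (simp only: side_rules; fail))+, (simp only: poly_arith)+)
next
  case 8
  show ?case
    by (rule pullback_square[OF satisfies_F6c, where k = 2 and e =
        "[:1, -12, 46, -20, -360, 1248, -2016, 1728, -960, 1280, -384, -1792, 512:]"],
      (rule syntactic_rules | (simp only: side_rules; fail))+, (simp only: poly_arith)+)
next
  case 9
  show ?case
    by (rule pullback_square[OF satisfies_F6c, where k = 1 and e =
        "[:1, -10, -56, 1400, -10320, 41280, -102144, 165120, -165120, 89600, -14336, -10240, 4096:]"],
      (rule syntactic_rules | (simp only: side_rules; fail))+, (simp only: poly_arith)+)
qed

lemma level6_G_common_solution:
  "\<forall>f\<in>set level6_G_functions. common_solution f"
  unfolding level6_G_functions_def list.set ball_simps
proof (intro conjI TrueI, goal_cases)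
  case 1
  show ?case
    by (rule pullback_linear[OF satisfies_G6a, where k = 1 and e =
        "[:1, -14, -11, 124, 28, -320, 64, 256, -128:]"],
      (rule syntactic_rules | (simp only: side_rules; fail))+, (simp only: poly_arith)+)
next
  case 2
  show ?case
    by (rule pullback_linear[OF satisfies_G6a, where k = 2 and e =
        "[:1, -12, 46, -20, -359, 1240, -2024, 1888, -1016, 288, -32:]"],
      (rule syntactic_rules | (simp only: side_rules; fail))+, (simp only: poly_arith)+)
next
  case 3
  show ?case
    by (rule pullback_linear[OF satisfies_G6a, where k = 1 and e =
        "[:1, -10, -55, 1416, -10280, 41152, -102752, 164608, -164480, 90624, -14080, -10240, 4096:]"],
      (rule syntactic_rules | (simp only: side_rules; fail))+, (simp only: poly_arith)+)
next
  case 4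
  show ?case
    by (rule pullback_linear[OF satisfies_G6b, where k = 1 and e =
        "[:1, -14, 52, 160, -1952, 7168, -14336, 16384, -8192:]"],
      (rule syntactic_rules | (simp only: side_rules; fail))+, (simp only: poly_arith)+)
next
  case 5
  show ?case
    by (rule pullback_linear[OF satisfies_G6b, where k = 2 and e =
        "[:1, -12, 46, -20, -296, 736, -224, -1856, 2944, 0, -2048:]"],
      (rule syntactic_rules | (simp only: side_rules; fail))+, (simp only: poly_arith)+)
next
  case 6
  show ?case
    by (rule pullback_linear[OF satisfies_G6b, where k = 1 and e =
        "[:1, -10, 8, 120, -272, -320, 1792, -1280, -4352, 7680, 2048, -10240, 4096:]"],
      (rule syntactic_rules | (simp only: side_rules; fail))+, (simp only: poly_arith)+)
next
  case 7
  show ?case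
    by (rule pullback_linear[OF satisfies_G6c, where k = 1 and e =
        "[:1, -14, 69, -164, 492, -1728, -576, 19200, -35712, -10240, 94208, -98304, 32768:]"],
      (rule syntactic_rules | (simp only: side_rules; fail))+, (simp only: poly_arith)+)
next
  case 8
  show ?case
    by (rule pullback_linear[OF satisfies_G6c, where k = 2 and e =
        "[:1, -12, 46, -20, -279, 600, -72, -864, 984, -1312, 2208, -1792, 512:]"],
      (rule syntactic_rules | (simp only: side_rules; fail))+, (simp only: poly_arith)+)
next
  case 9
  show ?case
    by (rule pullback_linear[OF satisfies_G6c, where k = 1 and e =
        "[:1, -10, 25, 104, -600, -192, 4128, -768, -9600, 6656, 6400, -10240, 4096:]"],
      (rule syntactic_rules | (simp only: side_rules; fail))+, (simp only: poly_arith)+)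
qed

theorem theorem3p1:
  shows "\<exists>U. open U \<and> 0 \<in> U \<and>
           (\<forall>p\<in>U. \<forall>f\<in>set all_functions. \<forall>g\<in>set all_functions. f p = g p)"
proof -
  have all: "common_solution f" if "f \<in> set all_functions" for f
    using that level1_common_solution level2_common_solution level3_common_solution
      level4_common_solution level6_F_common_solution level6_G_common_solution
    unfolding all_functions_def by auto
  have "\<forall>f\<in>set all_functions. \<forall>g\<in>set all_functions. eventually (\<lambda>p. f p = g p) (nhds 0)"
    using all by (blast intro: common_solution_unique)
  then have "eventually (\<lambda>p. \<forall>f\<in>set all_functions. \<forall>g\<in>set all_functions. f p = g p) (nhds 0)"
    by (intro eventually_ball_finite ballI) auto
  then show ?thesis by (auto simp: eventually_nhds)
qed

end
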